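(* Let $\mathfrak g$ be a finite-dimensional complex simple Lie algebra and let $q=e^{2\pi i n/m}$ ($n,m$ relatively prime positive integers) be a root of unity with $q^{d_i}\neq q^{-d_i}$ for all $i$. Let $L^{fin}(\lambda)$ be a unitary representation of the compact form $(X_i^\pm)^*=X_i^\mp$, $H_i^*=H_i$ of $U_q^{fin}(\mathfrak g)$ with inner product $(\cdot,\cdot)$, and let $L^{fin}(\lambda_r)=\mathbb C\rho_r$ be a one-dimensional representation of $U_q^{fin}(\mathfrak g)$ with weight $$\lambda_r=\sum_i r_iM_i\Lambda_i=\sum_i\frac{m}{2nd_i}p_i\Lambda_i,\qquad p_i\in\mathbb Z .$$ Then $L^{fin}(\lambda+\lambda_r)=L^{fin}(\lambda)\otimes L^{fin}(\lambda_r)$, with inner product $(v\otimes\rho_r,w\otimes\rho_r):=(v,w)$, is a unitary representation of the real form $$H_i^*=H_i,\qquad (X_i^\pm)^*=s_iX_i^\mp$$ of $U_q^{fin}(\mathfrak g)$, where $s_i=q_i^{M_ir_i}=\pm1$ (the value of $K_i=q^{d_iH_i}$ on the weight $\lambda_r$). All unitary representations of that real form can be obtained in this way.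
   Context: Notation: $\alpha_1,\dots,\alpha_r$ are the simple roots of $\mathfrak g$, $\Lambda_1,\dots,\Lambda_r$ the fundamental weights, $(\cdot,\cdot)$ on weight space is the invariant inner product normalized so that the $d_i=(\alpha_i,\alpha_i)/2$ are relatively prime integers, $A_{ij}=2(\alpha_i,\alpha_j)/(\alpha_j,\alpha_j)$, $q_i=q^{d_i}$, $[x]_{q_i}=\frac{q_i^x-q_i^{-x}}{q_i-q_i^{-1}}$; for rational $x$, $q^x:=e^{2\pi i nx/m}$. $M_i$ is the smallest positive integer with $[M_i]_{q_i}=0$. $U_q^{res}(\mathfrak g)$ is Lusztig's restricted specialization, with generators $X_i^{\pm(k)}=(X_i^\pm)^k/[k]_{q_i}!$ ($k\in\mathbb N$) and $H_i$, where $[H_i,H_j]=0$, $[H_i,X_j^\pm]=\pm A_{ji}X_j^\pm$, $[X_i^+,X_j^-]=\delta_{ij}[H_i]_{q_i}$, together with the quantum Serre relations. $U_q^{fin}(\mathfrak g)\subset U_q^{res}(\mathfrak g)$ is the subalgebra generated by the $X_i^\pm$ and $H_i$ only (in it $(X_i^\pm)^{M_i}=0$). The coproduct, used to define tensor products, is $\Delta(H_i)=H_i\otimes1+1\otimes H_i$, $\Delta(X_i^\pm)=X_i^\pm\otimes q^{d_iH_i/2}+q^{-d_iH_i/2}\otimes X_i^\pm$. $L^{fin}(\mu)$ is the irreducible highest weight module of $U_q^{fin}(\mathfrak g)$ with highest weight $\mu$ (not necessarily integral); $H_i$ acts on a vector of weight $\mu$ by $(\mu,\alpha_i^\vee)$,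 $\alpha_i^\vee=2\alpha_i/(\alpha_i,\alpha_i)$. The module $L^{fin}(\lambda_r)$ is one-dimensional precisely when $[r_iM_i]_{q_i}=0$ for all $i$, i.e. when $\lambda_r$ has the displayed form; here $r_i\in\mathbb Q$. For $s_i=\pm1$, the real form is the antilinear anti-algebra involution $*$ of $U_q^{fin}(\mathfrak g)$ with the stated values on generators. A representation on a space $V$ is unitary if $V$ has a positive definite Hermitian inner product (antilinear in the first argument) with $(v,x\cdot w)=(x^*\cdot v,w)$ for all $x$ in the algebra and $v,w\in V$. Since unitary representations are completely reducible, "unitary representation" here refers to irreducible highest weight modules $L^{fin}(\mu)$. *)

theory Defs
  imports
    Complex_Main
    "HOL-Library.Poly_Mapping"
    "HOL-Algebra.QuotRing"
    "HOL-Algebra.Generated_Rings"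
begin

section \<open>Complex simple Lie algebras and their weights\<close>

locale complex_simple_lie_algebra =
  vector_space sg for sg :: "complex \<Rightarrow> 'g \<Rightarrow> 'g::ab_group_add" +
  fixes br :: "'g \<Rightarrow> 'g \<Rightarrow> 'g"
  assumes finite_dim: "\<exists>B. finite B \<and> module.span sg B = UNIV"
    and bracket_linear: "Vector_Spaces.linear sg sg (br x)"
    and bracket_alternating: "br x x = 0"
    and jacobi: "br x (br y z) + br y (br z x) + br z (br x y) = 0"
    and not_abelian: "\<exists>x y. br x y \<noteq> 0"
    and no_proper_ideal:
      "\<lbrakk>module.subspace sg I; \<And>x y. y \<in> I \<Longrightarrow> br x y \<in> I\<rbrakk> \<Longrightarrow> I = {0} \<or> I = UNIV"

text \<open>For a semisimple Lie algebra the Cartan subalgebras are the self-centralizing abelian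
  subalgebras all of whose elements are ad-diagonalizable.\<close>

definition cartan_subalgebra ::
    "(complex \<Rightarrow> 'g \<Rightarrow> 'g::ab_group_add) \<Rightarrow> ('g \<Rightarrow> 'g \<Rightarrow> 'g) \<Rightarrow> 'g set \<Rightarrow> bool" where
  "cartan_subalgebra sg br h \<longleftrightarrow>
     module.subspace sg h \<and>
     (\<forall>x\<in>h. \<forall>y\<in>h. br x y = 0) \<and>
     (\<forall>x\<in>h. module.span sg {y. \<exists>c. br x y = sg c y} = UNIV) \<and>
     (\<forall>x. (\<forall>y\<in>h. br x y = 0) \<longrightarrow> x \<in> h)"

text \<open>Weights are elements of the dual of the Cartan subalgebra; a functional on \<open>h\<close> is encoded as
  a function on the whole Lie algebra that vanishes outside \<open>h\<close>.\<close>

definition weight_space ::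
    "(complex \<Rightarrow> 'g \<Rightarrow> 'g::ab_group_add) \<Rightarrow> 'g set \<Rightarrow> ('g \<Rightarrow> complex) set" where
  "weight_space sg h =
     {f. (\<forall>x\<in>h. \<forall>y\<in>h. f (x + y) = f x + f y) \<and> (\<forall>c. \<forall>x\<in>h. f (sg c x) = c * f x) \<and>
         (\<forall>x. x \<notin> h \<longrightarrow> f x = 0)}"

definition roots ::
    "(complex \<Rightarrow> 'g \<Rightarrow> 'g::ab_group_add) \<Rightarrow> ('g \<Rightarrow> 'g \<Rightarrow> 'g) \<Rightarrow> 'g set \<Rightarrow> ('g \<Rightarrow> complex) set" where
  "roots sg br h =
     {\<phi> \<in> weight_space sg h. \<phi> \<noteq> (\<lambda>_. 0) \<and> (\<exists>x. x \<noteq> 0 \<and> (\<forall>t\<in>h. br t x = sg (\<phi> t) x))}"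

definition lincomb :: "('i::finite \<Rightarrow> complex) \<Rightarrow> ('i \<Rightarrow> 'g \<Rightarrow> complex) \<Rightarrow> 'g \<Rightarrow> complex" where
  "lincomb c f = (\<lambda>x. \<Sum>i\<in>UNIV. c i * f i x)"

definition add_weight :: "('g \<Rightarrow> complex) \<Rightarrow> ('g \<Rightarrow> complex) \<Rightarrow> 'g \<Rightarrow> complex" where
  "add_weight \<mu> \<nu> = (\<lambda>x. \<mu> x + \<nu> x)"

definition simple_roots ::
    "(complex \<Rightarrow> 'g \<Rightarrow> 'g::ab_group_add) \<Rightarrow> ('g \<Rightarrow> 'g \<Rightarrow> 'g) \<Rightarrow> 'g set \<Rightarrow>
     ('i::finite \<Rightarrow> 'g \<Rightarrow> complex) \<Rightarrow> bool" where
  "simple_roots sg br h \<alpha> \<longleftrightarrow>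
     (\<forall>i. \<alpha> i \<in> roots sg br h) \<and>
     (\<forall>c. lincomb c \<alpha> = (\<lambda>_. 0) \<longrightarrow> (\<forall>i. c i = 0)) \<and>
     (\<forall>\<phi>\<in>roots sg br h. \<exists>k::'i \<Rightarrow> nat.
        \<phi> = lincomb (\<lambda>i. of_nat (k i)) \<alpha> \<or> \<phi> = lincomb (\<lambda>i. - of_nat (k i)) \<alpha>)"

text \<open>A bilinear form on the weight space is invariant if it is dual to the restriction to \<open>h\<close> of a
  nondegenerate ad-invariant symmetric form \<open>\<beta>\<close>, i.e. \<open>(\<beta>(t,-), \<beta>(u,-)) = \<beta>(t,u)\<close>. As the Lie algebra
  is simple, this determines the form up to a scalar.\<close>

definition invariant_weight_form ::
    "(complex \<Rightarrow> 'g \<Rightarrow> 'g::ab_group_add) \<Rightarrow> ('g \<Rightarrow> 'g \<Rightarrow> 'g) \<Rightarrow> 'g set \<Rightarrow>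
     (('g \<Rightarrow> complex) \<Rightarrow> ('g \<Rightarrow> complex) \<Rightarrow> complex) \<Rightarrow> bool" where
  "invariant_weight_form sg br h B \<longleftrightarrow>
     (\<forall>f\<in>weight_space sg h. \<forall>g\<in>weight_space sg h. B f g = B g f) \<and>
     (\<forall>f\<in>weight_space sg h. \<forall>g\<in>weight_space sg h. \<forall>k\<in>weight_space sg h.
        B (\<lambda>x. f x + g x) k = B f k + B g k) \<and>
     (\<forall>c. \<forall>f\<in>weight_space sg h. \<forall>k\<in>weight_space sg h. B (\<lambda>x. c * f x) k = c * B f k) \<and>
     (\<exists>\<beta>. (\<forall>x y. \<beta> x y = \<beta> y x) \<and>
          (\<forall>x y z. \<beta> (x + y) z = \<beta> x z + \<beta> y z) \<and>
          (\<forall>c x z. \<beta> (sg c x) z = c * \<beta> x z) \<and>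
          (\<forall>x y z. \<beta> (br x y) z = \<beta> x (br y z)) \<and>
          (\<forall>x. (\<forall>y. \<beta> x y = 0) \<longrightarrow> x = 0) \<and>
          (\<forall>t\<in>h. \<forall>u\<in>h.
             B (\<lambda>x. if x \<in> h then \<beta> t x else 0) (\<lambda>x. if x \<in> h then \<beta> u x else 0) = \<beta> t u))"

definition coroot_pairing ::
    "(('g \<Rightarrow> complex) \<Rightarrow> ('g \<Rightarrow> complex) \<Rightarrow> complex) \<Rightarrow> ('i \<Rightarrow> 'g \<Rightarrow> complex) \<Rightarrow>
     ('g \<Rightarrow> complex) \<Rightarrow> 'i \<Rightarrow> complex" where
  "coroot_pairing B \<alpha> \<mu> i = 2 * B \<mu> (\<alpha> i) / B (\<alpha> i) (\<alpha> i)"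

record 'i quantum_data =
  cartan :: "'i \<Rightarrow> 'i \<Rightarrow> int"
  symm :: "'i \<Rightarrow> nat"
  qnum :: nat
  qden :: nat

text \<open>\<open>cartan Q i j\<close> is \<open>A\<^sub>i\<^sub>j = 2(\<alpha>\<^sub>i,\<alpha>\<^sub>j)/(\<alpha>\<^sub>j,\<alpha>\<^sub>j)\<close>, so that \<open>(\<alpha>\<^sub>j, \<alpha>\<^sub>i\<^sup>\<or>) = cartan Q j i\<close>; \<open>symm Q i\<close> is
  \<open>d\<^sub>i = (\<alpha>\<^sub>i,\<alpha>\<^sub>i)/2\<close>; and \<open>q\<close> is \<open>e\<close> to the power \<open>2\<pi>i\<cdot>qnum Q/qden Q\<close>. Positivity and coprimality of
  the \<open>d\<^sub>i\<close> fix the scale of the form \<open>B\<close>.\<close>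

locale simple_lie_weight_data =
  complex_simple_lie_algebra sg br
  for sg :: "complex \<Rightarrow> 'g \<Rightarrow> 'g::ab_group_add" and br :: "'g \<Rightarrow> 'g \<Rightarrow> 'g" +
  fixes h :: "'g set"
    and \<alpha> \<Lambda> :: "'i::finite \<Rightarrow> 'g \<Rightarrow> complex"
    and B :: "('g \<Rightarrow> complex) \<Rightarrow> ('g \<Rightarrow> complex) \<Rightarrow> complex"
    and Q :: "'i quantum_data"
  assumes cartan_subalgebra: "cartan_subalgebra sg br h"
    and simple_roots: "simple_roots sg br h \<alpha>"
    and invariant_form: "invariant_weight_form sg br h B"
    and symm_eq: "of_nat (symm Q i) = B (\<alpha> i) (\<alpha> i) / 2"
    and symm_pos: "0 < symm Q i"
    and symm_coprime: "Gcd (range (symm Q)) = 1"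
    and cartan_eq: "of_int (cartan Q i j) = 2 * B (\<alpha> i) (\<alpha> j) / B (\<alpha> j) (\<alpha> j)"
    and fundamental_weight: "\<Lambda> i \<in> weight_space sg h"
    and fundamental_weight_pairing: "coroot_pairing B \<alpha> (\<Lambda> i) j = (if i = j then 1 else 0)"


section \<open>Quantum numbers at the root of unity\<close>

definition qpow :: "'i quantum_data \<Rightarrow> complex \<Rightarrow> complex" where
  "qpow Q x = exp (2 * of_real pi * \<i> * of_nat (qnum Q) * x / of_nat (qden Q))"

definition qbase :: "'i quantum_data \<Rightarrow> 'i \<Rightarrow> complex" where
  "qbase Q i = qpow Q (of_nat (symm Q i))"

definition qint :: "'i quantum_data \<Rightarrow> 'i \<Rightarrow> complex \<Rightarrow> complex" where
  "qint Q i x =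
     (qpow Q (of_nat (symm Q i) * x) - qpow Q (- (of_nat (symm Q i) * x))) /
     (qbase Q i - inverse (qbase Q i))"

definition qorder :: "'i quantum_data \<Rightarrow> 'i \<Rightarrow> nat" where
  "qorder Q i = (LEAST k. 0 < k \<and> qint Q i (of_nat k) = 0)"

text \<open>The Gaussian binomial \<open>[n]!/([k]![n-k]!)\<close>, symmetric under \<open>z \<mapsto> z\<inverse>\<close>, evaluated at \<open>z\<close> by its
  Pascal recursion: at a root of unity the quotient of factorials may be \<open>0/0\<close>.\<close>

fun gauss_binom :: "complex \<Rightarrow> nat \<Rightarrow> nat \<Rightarrow> complex" where
  "gauss_binom z n 0 = 1"
| "gauss_binom z 0 (Suc k) = 0"
| "gauss_binom z (Suc n) (Suc k) =
     inverse z ^ Suc k * gauss_binom z n (Suc k) + z ^ (n - k) * gauss_binom z n k"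


section \<open>The quantum groups\<close>

text \<open>The Boolean argument of a generator is a sign: \<open>GX True i k\<close> and \<open>GX False i k\<close> are the divided
  powers \<open>X\<^sub>i\<close> to the \<open>\<plusminus>(k)\<close>. The exponentials \<open>q\<close> to the \<open>\<plusminus>d\<^sub>iH\<^sub>i/2\<close>, which occur in \<open>[H\<^sub>i]\<close> and in the
  coproduct, are infinite series in \<open>H\<^sub>i\<close>; they are adjoined as the generators \<open>GQ True i\<close> and
  \<open>GQ False i\<close> together with the relations that they satisfy as functions of \<open>H\<^sub>i\<close>.\<close>

datatype 'i gen = GX bool 'i nat | GH 'i | GQ bool 'i

datatype 'a free_word = Word (letters: "'a list")

instantiation free_word :: (type) monoid_add
begin
definition zero_free_word :: "'a free_word" where "zero_free_word = Word []"
definition plus_free_word :: "'a free_word \<Rightarrow> 'a free_word \<Rightarrow> 'a free_word" where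
  "plus_free_word u v = Word (letters u @ letters v)"
instance by standard (simp_all add: zero_free_word_def plus_free_word_def)
end

text \<open>Finitely supported functions on words under convolution: the free associative unital algebra.\<close>

type_synonym 'i free_alg = "'i gen free_word \<Rightarrow>\<^sub>0 complex"

definition fconst :: "complex \<Rightarrow> 'i free_alg" where
  "fconst c = Poly_Mapping.single 0 c"

definition fgen :: "'i gen \<Rightarrow> 'i free_alg" where
  "fgen g = Poly_Mapping.single (Word [g]) 1"

text \<open>The divided powers \<open>(X\<^sub>i)\<close> to the \<open>k\<close> over \<open>[k]!\<close> enter through their multiplication rule, which implies
  that the \<open>k\<close>-th power of \<open>X\<^sub>i\<close> is \<open>[k]!\<close> times the \<open>k\<close>-th divided power, hence is \<open>0\<close> for \<open>k = M\<^sub>i\<close>. Commutators of higher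
  divided powers of opposite sign are not imposed: already the one of the \<open>M\<^sub>i\<close>-th divided power of
  \<open>X\<^sub>i\<^sup>+\<close> with \<open>X\<^sub>i\<^sup>-\<close> would force \<open>q\<^sub>i\<close> to the \<open>2M\<^sub>iH\<^sub>i\<close> to be \<open>1\<close> and so restrict the possible weights.\<close>

definition pm :: "bool \<Rightarrow> int" where
  "pm e = (if e then 1 else - 1)"

inductive_set relators :: "'i quantum_data \<Rightarrow> 'i free_alg set" for Q :: "'i quantum_data" where
  divided_0: "fgen (GX e i 0) - 1 \<in> relators Q"
| divided_mult:
    "fgen (GX e i k) * fgen (GX e i l)
       - fconst (gauss_binom (qbase Q i) (k + l) k) * fgen (GX e i (k + l)) \<in> relators Q"
| H_H: "fgen (GH i) * fgen (GH j) - fgen (GH j) * fgen (GH i) \<in> relators Q"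
| Q_inverse: "fgen (GQ e i) * fgen (GQ (\<not> e) i) - 1 \<in> relators Q"
| Q_Q: "fgen (GQ e i) * fgen (GQ e' j) - fgen (GQ e' j) * fgen (GQ e i) \<in> relators Q"
| Q_H: "fgen (GQ e i) * fgen (GH j) - fgen (GH j) * fgen (GQ e i) \<in> relators Q"
| H_X:
    "fgen (GH i) * fgen (GX e j k) - fgen (GX e j k) * fgen (GH i)
       - fconst (of_int (pm e * int k * cartan Q j i)) * fgen (GX e j k) \<in> relators Q"
| Q_X:
    "fgen (GQ e' i) * fgen (GX e j k)
       - fconst (qpow Q (of_int (pm e' * pm e * int k * int (symm Q i) * cartan Q j i) / 2))
         * fgen (GX e j k) * fgen (GQ e' i) \<in> relators Q"
| X_X:
    "fgen (GX True i 1) * fgen (GX False j 1) - fgen (GX False j 1) * fgen (GX True i 1)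
       - (if i = j
          then fconst (1 / (qbase Q i - inverse (qbase Q i)))
               * (fgen (GQ True i) * fgen (GQ True i) - fgen (GQ False i) * fgen (GQ False i))
          else 0) \<in> relators Q"
| serre:
    "i \<noteq> j \<Longrightarrow> N = nat (1 - cartan Q j i) \<Longrightarrow>
     (\<Sum>k\<le>N. fconst ((- 1) ^ k) * fgen (GX e i (N - k)) * fgen (GX e j 1) * fgen (GX e i k))
       \<in> relators Q"

definition free_ring :: "'i free_alg ring" where
  "free_ring = \<lparr>carrier = UNIV, mult = (*), one = 1, zero = 0, add = (+)\<rparr>"

definition rel_ideal :: "'i quantum_data \<Rightarrow> 'i free_alg set" where
  "rel_ideal Q = genideal free_ring (relators Q)"

definition U_res :: "'i quantum_data \<Rightarrow> 'i free_alg set ring" where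
  "U_res Q = free_ring Quot rel_ideal Q"

definition cls :: "'i quantum_data \<Rightarrow> 'i free_alg \<Rightarrow> 'i free_alg set" where
  "cls Q a = rel_ideal Q +>\<^bsub>free_ring\<^esub> a"

definition scal :: "'i quantum_data \<Rightarrow> complex \<Rightarrow> 'i free_alg set" where
  "scal Q c = cls Q (fconst c)"

definition X :: "'i quantum_data \<Rightarrow> bool \<Rightarrow> 'i \<Rightarrow> 'i free_alg set" where
  "X Q e i = cls Q (fgen (GX e i 1))"

definition H :: "'i quantum_data \<Rightarrow> 'i \<Rightarrow> 'i free_alg set" where
  "H Q i = cls Q (fgen (GH i))"

definition qH :: "'i quantum_data \<Rightarrow> bool \<Rightarrow> 'i \<Rightarrow> 'i free_alg set" where
  "qH Q e i = cls Q (fgen (GQ e i))"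

definition K :: "'i quantum_data \<Rightarrow> 'i \<Rightarrow> 'i free_alg set" where
  "K Q i = qH Q True i \<otimes>\<^bsub>U_res Q\<^esub> qH Q True i"

text \<open>Including the scalars among the ring generators makes the generated subring a subalgebra.\<close>

definition U_fin :: "'i quantum_data \<Rightarrow> 'i free_alg set ring" where
  "U_fin Q = (U_res Q)
     \<lparr>carrier := generate_ring (U_res Q)
        (range (scal Q) \<union> {X Q e i | e i. True} \<union> range (H Q) \<union> {qH Q e i | e i. True})\<rparr>"


section \<open>Representations and real forms\<close>

definition rep ::
    "'i quantum_data \<Rightarrow> (complex \<Rightarrow> 'v \<Rightarrow> 'v::ab_group_add) \<Rightarrow> ('i free_alg set \<Rightarrow> 'v \<Rightarrow> 'v) \<Rightarrow> bool" where
  "rep Q sv \<pi> \<longleftrightarrow>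
     vector_space sv \<and>
     (\<forall>x\<in>carrier (U_fin Q). Vector_Spaces.linear sv sv (\<pi> x)) \<and>
     (\<forall>x\<in>carrier (U_fin Q). \<forall>y\<in>carrier (U_fin Q). \<forall>v.
        \<pi> (x \<oplus>\<^bsub>U_fin Q\<^esub> y) v = \<pi> x v + \<pi> y v \<and> \<pi> (x \<otimes>\<^bsub>U_fin Q\<^esub> y) v = \<pi> x (\<pi> y v)) \<and>
     (\<forall>c v. \<pi> (scal Q c) v = sv c v)"

definition irreducible_rep ::
    "'i quantum_data \<Rightarrow> (complex \<Rightarrow> 'v \<Rightarrow> 'v::ab_group_add) \<Rightarrow> ('i free_alg set \<Rightarrow> 'v \<Rightarrow> 'v) \<Rightarrow> bool" where
  "irreducible_rep Q sv \<pi> \<longleftrightarrow>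
     rep Q sv \<pi> \<and> (\<exists>v::'v. v \<noteq> 0) \<and>
     (\<forall>S. module.subspace sv S \<and> (\<forall>x\<in>carrier (U_fin Q). \<pi> x ` S \<subseteq> S) \<longrightarrow> S = {0} \<or> S = UNIV)"

text \<open>The argument \<open>l\<close> lists the numbers \<open>(\<mu>, \<alpha>\<^sub>i\<^sup>\<or>)\<close> of a weight \<open>\<mu>\<close>. The last clause says that the
  adjoined exponentials act as the exponentials of \<open>H\<^sub>i\<close>.\<close>

definition weight_vector ::
    "'i quantum_data \<Rightarrow> (complex \<Rightarrow> 'v \<Rightarrow> 'v) \<Rightarrow> ('i free_alg set \<Rightarrow> 'v \<Rightarrow> 'v) \<Rightarrow>
     ('i \<Rightarrow> complex) \<Rightarrow> 'v \<Rightarrow> bool" where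
  "weight_vector Q sv \<pi> l v \<longleftrightarrow>
     (\<forall>i. \<pi> (H Q i) v = sv (l i) v) \<and>
     (\<forall>e i. \<pi> (qH Q e i) v = sv (qpow Q (of_int (pm e * int (symm Q i)) * l i / 2)) v)"

text \<open>\<open>\<pi>\<close> is (a model of) the irreducible highest weight module with highest weight \<open>l\<close>.\<close>

definition L_fin ::
    "'i quantum_data \<Rightarrow> ('i \<Rightarrow> complex) \<Rightarrow> (complex \<Rightarrow> 'v \<Rightarrow> 'v::ab_group_add) \<Rightarrow>
     ('i free_alg set \<Rightarrow> 'v \<Rightarrow> 'v) \<Rightarrow> bool" where
  "L_fin Q l sv \<pi> \<longleftrightarrow>
     irreducible_rep Q sv \<pi> \<and>
     (\<exists>v. v \<noteq> 0 \<and> weight_vector Q sv \<pi> l v \<and> (\<forall>i. \<pi> (X Q True i) v = 0))"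

definition one_dimensional :: "(complex \<Rightarrow> 'w \<Rightarrow> 'w::ab_group_add) \<Rightarrow> 'w \<Rightarrow> bool" where
  "one_dimensional sw \<rho> \<longleftrightarrow> \<rho> \<noteq> 0 \<and> module.span sw {\<rho>} = UNIV"

definition real_form ::
    "'i quantum_data \<Rightarrow> ('i \<Rightarrow> complex) \<Rightarrow> ('i free_alg set \<Rightarrow> 'i free_alg set) \<Rightarrow> bool" where
  "real_form Q s \<sigma> \<longleftrightarrow>
     (\<forall>x\<in>carrier (U_fin Q). \<sigma> x \<in> carrier (U_fin Q) \<and> \<sigma> (\<sigma> x) = x) \<and>
     (\<forall>x\<in>carrier (U_fin Q). \<forall>y\<in>carrier (U_fin Q).
        \<sigma> (x \<oplus>\<^bsub>U_fin Q\<^esub> y) = \<sigma> x \<oplus>\<^bsub>U_fin Q\<^esub> \<sigma> y \<and> \<sigma> (x \<otimes>\<^bsub>U_fin Q\<^esub> y) = \<sigma> y \<otimes>\<^bsub>U_fin Q\<^esub> \<sigma> x) \<and>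
     (\<forall>c. \<sigma> (scal Q c) = scal Q (cnj c)) \<and>
     (\<forall>i. \<sigma> (H Q i) = H Q i) \<and>
     (\<forall>e i. \<sigma> (qH Q e i) = qH Q (\<not> e) i) \<and>
     (\<forall>e i. \<sigma> (X Q e i) = scal Q (s i) \<otimes>\<^bsub>U_fin Q\<^esub> X Q (\<not> e) i)"

definition hermitian_inner_product ::
    "(complex \<Rightarrow> 'v \<Rightarrow> 'v::ab_group_add) \<Rightarrow> ('v \<Rightarrow> 'v \<Rightarrow> complex) \<Rightarrow> bool" where
  "hermitian_inner_product sv ip \<longleftrightarrow>
     (\<forall>u v w. ip u (v + w) = ip u v + ip u w) \<and>
     (\<forall>c v w. ip v (sv c w) = c * ip v w) \<and>
     (\<forall>v w. ip w v = cnj (ip v w)) \<and>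
     (\<forall>v. v \<noteq> 0 \<longrightarrow> 0 < Re (ip v v))"

text \<open>The values on generators determine the involution \<open>\<sigma>\<close>, so the quantifier over \<open>\<sigma>\<close> only
  asserts that the real form exists.\<close>

definition unitary_rep ::
    "'i quantum_data \<Rightarrow> ('i \<Rightarrow> complex) \<Rightarrow> (complex \<Rightarrow> 'v \<Rightarrow> 'v::ab_group_add) \<Rightarrow>
     ('i free_alg set \<Rightarrow> 'v \<Rightarrow> 'v) \<Rightarrow> ('v \<Rightarrow> 'v \<Rightarrow> complex) \<Rightarrow> bool" where
  "unitary_rep Q s sv \<pi> ip \<longleftrightarrow>
     rep Q sv \<pi> \<and> hermitian_inner_product sv ip \<and>
     (\<exists>\<sigma>. real_form Q s \<sigma> \<and>
        (\<forall>x\<in>carrier (U_fin Q). \<forall>v w. ip v (\<pi> x w) = ip (\<pi> (\<sigma> x) v) w))"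

text \<open>A one-dimensional module with basis vector \<open>\<rho>\<close> and weight
  \<open>\<lambda>\<^sub>r = \<Sum> r\<^sub>iM\<^sub>i\<Lambda>\<^sub>i = \<Sum> (m/2nd\<^sub>i) p\<^sub>i\<Lambda>\<^sub>i\<close>, and the numbers \<open>s\<^sub>i\<close>, which are \<open>q\<^sub>i\<close> to the \<open>M\<^sub>ir\<^sub>i\<close>.\<close>

definition one_dim_rep ::
    "'i::finite quantum_data \<Rightarrow> (('g \<Rightarrow> complex) \<Rightarrow> ('g \<Rightarrow> complex) \<Rightarrow> complex) \<Rightarrow>
     ('i \<Rightarrow> 'g \<Rightarrow> complex) \<Rightarrow> ('i \<Rightarrow> 'g \<Rightarrow> complex) \<Rightarrow> ('i \<Rightarrow> int) \<Rightarrow> ('i \<Rightarrow> rat) \<Rightarrow>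
     ('g \<Rightarrow> complex) \<Rightarrow> ('i \<Rightarrow> complex) \<Rightarrow> (complex \<Rightarrow> 'w \<Rightarrow> 'w::ab_group_add) \<Rightarrow>
     ('i free_alg set \<Rightarrow> 'w \<Rightarrow> 'w) \<Rightarrow> 'w \<Rightarrow> bool" where
  "one_dim_rep Q B \<alpha> \<Lambda> p r lam\<^sub>r s sw \<pi> \<rho> \<longleftrightarrow>
     (\<forall>i. of_rat (r i) * of_nat (qorder Q i) =
        of_nat (qden Q) / (2 * of_nat (qnum Q) * of_nat (symm Q i)) * (of_int (p i) :: complex)) \<and>
     lam\<^sub>r = lincomb (\<lambda>i. of_rat (r i) * of_nat (qorder Q i)) \<Lambda> \<and>
     (\<forall>i. s i = qpow Q (of_nat (symm Q i) * (of_nat (qorder Q i) * of_rat (r i)))) \<and>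
     L_fin Q (coroot_pairing B \<alpha> lam\<^sub>r) sw \<pi> \<and>
     one_dimensional sw \<rho>"


section \<open>Tensor products\<close>

definition is_basis :: "(complex \<Rightarrow> 'v \<Rightarrow> 'v::ab_group_add) \<Rightarrow> 'v set \<Rightarrow> bool" where
  "is_basis sv S \<longleftrightarrow> \<not> module.dependent sv S \<and> module.span sv S = UNIV"

definition tensor_product ::
    "(complex \<Rightarrow> 'v \<Rightarrow> 'v::ab_group_add) \<Rightarrow> (complex \<Rightarrow> 'w \<Rightarrow> 'w::ab_group_add) \<Rightarrow>
     (complex \<Rightarrow> 't \<Rightarrow> 't::ab_group_add) \<Rightarrow> ('v \<Rightarrow> 'w \<Rightarrow> 't) \<Rightarrow> bool" where
  "tensor_product sv sw st t \<longleftrightarrow>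
     vector_space st \<and>
     (\<forall>w. Vector_Spaces.linear sv st (\<lambda>v. t v w)) \<and>
     (\<forall>v. Vector_Spaces.linear sw st (t v)) \<and>
     (\<forall>S R. is_basis sv S \<and> is_basis sw R \<longrightarrow>
        inj_on (\<lambda>(v, w). t v w) (S \<times> R) \<and> is_basis st ((\<lambda>(v, w). t v w) ` (S \<times> R)))"

text \<open>The representation on a tensor product given by the coproduct
  \<open>\<Delta>(H\<^sub>i) = H\<^sub>i \<otimes> 1 + 1 \<otimes> H\<^sub>i\<close>,
  \<open>\<Delta>(X\<^sub>i) = X\<^sub>i \<otimes> qH True i + qH False i \<otimes> X\<^sub>i\<close>; the exponentials are group-like because \<open>H\<^sub>i\<close> is primitive.\<close>

definition tensor_rep ::
    "'i quantum_data \<Rightarrow> (complex \<Rightarrow> 't \<Rightarrow> 't::ab_group_add) \<Rightarrow> ('v \<Rightarrow> 'w \<Rightarrow> 't) \<Rightarrow>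
     ('i free_alg set \<Rightarrow> 'v \<Rightarrow> 'v) \<Rightarrow> ('i free_alg set \<Rightarrow> 'w \<Rightarrow> 'w) \<Rightarrow>
     ('i free_alg set \<Rightarrow> 't \<Rightarrow> 't) \<Rightarrow> bool" where
  "tensor_rep Q st t \<pi>\<^sub>1 \<pi>\<^sub>2 \<pi> \<longleftrightarrow>
     rep Q st \<pi> \<and>
     (\<forall>i v w. \<pi> (H Q i) (t v w) = t (\<pi>\<^sub>1 (H Q i) v) w + t v (\<pi>\<^sub>2 (H Q i) w)) \<and>
     (\<forall>e i v w. \<pi> (qH Q e i) (t v w) = t (\<pi>\<^sub>1 (qH Q e i) v) (\<pi>\<^sub>2 (qH Q e i) w)) \<and>
     (\<forall>e i v w. \<pi> (X Q e i) (t v w) =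
        t (\<pi>\<^sub>1 (X Q e i) v) (\<pi>\<^sub>2 (qH Q True i) w) + t (\<pi>\<^sub>1 (qH Q False i) v) (\<pi>\<^sub>2 (X Q e i) w))"

end

(* The assignment X_i^+- |-> a_i X_i^+-, H_i |-> H_i + l_i, q^(+-d_i H_i / 2) |-> a_i^(+-1) q^(+-d_i H_i / 2)
   respects all relations as soon as a_i^4 = 1, so it defines an automorphism of the quantum group with
   inverse given by (1/a, -l). On a one-dimensional module of weight lambda_r the X_i^+- act as 0, so by
   the coproduct tensoring with it amounts to twisting by this automorphism with l_i = (lambda_r, alpha_i^v)
   and a_i = q^(d_i l_i / 2), where a_i^2 = s_i = +-1. Conjugating a real form with signs s'_i by the
   automorphism gives the one with signs s'_i a_i^2, since conj(a_i) = 1/a_i. Both directions of the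
   theorem follow by twisting with the automorphism and with its inverse. *)

theory Submission
  imports Defs
begin

section \<open>The free algebra and the quantum group\<close>

text \<open>The factor a_i is the same for both signs of X_i because the coproduct puts q^(d_i H_i /
  2) to the right of X_i^+ and of X_i^- alike. Thus [X_i^+, X_i^-] is multiplied by a_i^2, whereas
  K_i gets a_i^2 and its inverse gets a_i^(-2); the commutator relation asks these to agree, which
  is the origin of a_i^4 = 1. The weights lambda_r meet this condition because a_i^2 = q^(d_i l_i) =
  e^(pi i p_i), so that s_i records the parity of p_i. The shift l_i and the factor a_i are
  independent parameters of the automorphism, since the exponentials are generators of their own.
  They are tied together only when exponentials must act on a weight vector as exponentials of H_i.
  No real form is constructed from its values on generators: a unitary module comes with an
  involution, and the required one is a conjugate of it. Likewise, the one-dimensional modules that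
  have to exist are twists of the counit.\<close>

lemma ring_free_ring: "ring free_ring"
  by unfold_locales
    (auto simp: free_ring_def algebra_simps Units_def intro: exI[of _ "- x" for x])

lemma free_ring_simps [simp]:
  "carrier free_ring = UNIV" "x \<otimes>\<^bsub>free_ring\<^esub> y = x * y" "x \<oplus>\<^bsub>free_ring\<^esub> y = x + y"
  "\<one>\<^bsub>free_ring\<^esub> = 1" "\<zero>\<^bsub>free_ring\<^esub> = 0"
  by (simp_all add: free_ring_def)

lemma a_inv_free_ring [simp]: "\<ominus>\<^bsub>free_ring\<^esub> x = - x"
proof -
  interpret ring free_ring by (rule ring_free_ring)
  show ?thesis by (rule minus_equality) auto
qed

lemma ideal_rel_ideal: "ideal (rel_ideal Q) free_ring"
proof -
  interpret ring free_ring by (rule ring_free_ring)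
  show ?thesis unfolding rel_ideal_def by (rule genideal_ideal) simp
qed

lemma relators_in_rel_ideal: "x \<in> relators Q \<Longrightarrow> x \<in> rel_ideal Q"
proof -
  interpret ring free_ring by (rule ring_free_ring)
  show "x \<in> relators Q \<Longrightarrow> x \<in> rel_ideal Q"
    unfolding rel_ideal_def using genideal_self[of "relators Q"] by auto
qed

lemma rel_ideal_add: "x \<in> rel_ideal Q \<Longrightarrow> y \<in> rel_ideal Q \<Longrightarrow> x + y \<in> rel_ideal Q"
proof -
  interpret ideal "rel_ideal Q" free_ring by (rule ideal_rel_ideal)
  show "x \<in> rel_ideal Q \<Longrightarrow> y \<in> rel_ideal Q \<Longrightarrow> x + y \<in> rel_ideal Q"
    using additive_subgroup.a_closed[OF is_additive_subgroup, of x y] by simp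
qed

lemma rel_ideal_mult:
  "x \<in> rel_ideal Q \<Longrightarrow> y * x \<in> rel_ideal Q" "x \<in> rel_ideal Q \<Longrightarrow> x * y \<in> rel_ideal Q"
proof -
  interpret ideal "rel_ideal Q" free_ring by (rule ideal_rel_ideal)
  show "x \<in> rel_ideal Q \<Longrightarrow> y * x \<in> rel_ideal Q" "x \<in> rel_ideal Q \<Longrightarrow> x * y \<in> rel_ideal Q"
    using I_l_closed[of x y] I_r_closed[of x y] by simp_all
qed

lemma rel_ideal_0: "0 \<in> rel_ideal Q"
proof -
  interpret ideal "rel_ideal Q" free_ring by (rule ideal_rel_ideal)
  show ?thesis using additive_subgroup.zero_closed[OF is_additive_subgroup] by simp
qed

text \<open>The elements satisfying \<open>P\<close> form an ideal containing the relators, so they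
  contain the generated ideal. Closure under negation needs no case of its own, being left
  multiplication by -1.\<close>

lemma rel_ideal_induct [consumes 1, case_names relator zero add left right]:
  assumes "x \<in> rel_ideal Q"
    and "\<And>x. x \<in> relators Q \<Longrightarrow> P x" and zero: "P 0"
    and add: "\<And>x y. P x \<Longrightarrow> P y \<Longrightarrow> P (x + y)"
    and left: "\<And>x y. P x \<Longrightarrow> P (y * x)" and right: "\<And>x y. P x \<Longrightarrow> P (x * y)"
  shows "P x"
proof -
  interpret ring free_ring by (rule ring_free_ring)
  have uminus: "P (- x)" if "P x" for x
    using left[OF that, of "- 1"] by simp
  have "ideal {x. P x} free_ring"
  proof (rule idealI)
    show "subgroup {x. P x} (add_monoid free_ring)"
    proof (rule group.subgroupI[OF a_group])
      show "{x. P x} \<noteq> {}" using zero by auto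
      show "inv\<^bsub>add_monoid free_ring\<^esub> a \<in> {x. P x}" if "a \<in> {x. P x}" for a
        using that uminus a_inv_free_ring[of a] by (simp add: a_inv_def)
    qed (auto intro: add)
  qed (auto intro: left right ring_free_ring)
  moreover have "relators Q \<subseteq> {x. P x}" using assms(2) by auto
  ultimately show ?thesis
    using genideal_minimal assms(1) unfolding rel_ideal_def by blast
qed

lemma cls_add: "cls Q a \<oplus>\<^bsub>U_res Q\<^esub> cls Q b = cls Q (a + b)"
  and cls_mult: "cls Q a \<otimes>\<^bsub>U_res Q\<^esub> cls Q b = cls Q (a * b)"
  and cls_one: "\<one>\<^bsub>U_res Q\<^esub> = cls Q 1"
  and carrier_U_res: "carrier (U_res Q) = range (cls Q)"
  and ring_U_res: "ring (U_res Q)"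
proof -
  interpret ideal "rel_ideal Q" free_ring by (rule ideal_rel_ideal)
  note h = ring_hom_memE[OF rcos_ring_hom]
  show "cls Q a \<oplus>\<^bsub>U_res Q\<^esub> cls Q b = cls Q (a + b)" "cls Q a \<otimes>\<^bsub>U_res Q\<^esub> cls Q b = cls Q (a * b)"
    "\<one>\<^bsub>U_res Q\<^esub> = cls Q 1"
    using h(2)[of a b] h(3)[of a b] h(4) by (simp_all add: U_res_def cls_def)
  show "carrier (U_res Q) = range (cls Q)"
    by (auto simp: U_res_def cls_def FactRing_def A_RCOSETS_def')
  show "ring (U_res Q)" unfolding U_res_def by (rule quotient_is_ring)
qed

lemma cls_eq_iff: "cls Q a = cls Q b \<longleftrightarrow> a - b \<in> rel_ideal Q"
proof -
  interpret ideal "rel_ideal Q" free_ring by (rule ideal_rel_ideal)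
  have "a \<ominus>\<^bsub>free_ring\<^esub> b = a - b" by (simp add: a_minus_def)
  then show ?thesis
    using quotient_eq_iff_same_a_r_cos[OF ideal_rel_ideal, of a b] by (simp add: cls_def)
qed

lemma fconst_add: "fconst (a + b) = fconst a + fconst b"
  by (simp add: fconst_def single_add)

lemma fconst_mult: "fconst (a * b) = fconst a * fconst b"
  by (simp add: fconst_def mult_single)

lemma fconst_0 [simp]: "fconst 0 = 0" and fconst_1 [simp]: "fconst 1 = 1"
  by (simp_all add: fconst_def)

lemma fconst_uminus: "fconst (- a) = - fconst a"
  by (simp add: fconst_def single_uminus)

lemma poly_mapping_single_induct [case_names single add]:
  fixes a :: "'a \<Rightarrow>\<^sub>0 'b::ab_group_add"
  assumes "\<And>k v. P (Poly_Mapping.single k v)" and "\<And>a b. P a \<Longrightarrow> P b \<Longrightarrow> P (a + b)"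
  shows "P a"
proof (induction a rule: update_induct)
  case const
  show ?case using assms(1)[of undefined 0] by simp
next
  case (update f k v)
  have "Poly_Mapping.update k v f = f + Poly_Mapping.single k (v - Poly_Mapping.lookup f k)"
    by (rule poly_mapping_eqI) (simp add: lookup_update lookup_add lookup_single when_def)
  then show ?case using assms update by metis
qed

lemma fconst_central: "fconst c * a = a * fconst c"
  by (induction a rule: poly_mapping_single_induct)
    (simp_all add: fconst_def mult_single algebra_simps)

section \<open>Algebra homomorphisms given by their values on generators\<close>

text \<open>A central unital ring homomorphism from the complex numbers turns the ring into a
  complex algebra. Two targets are used: the free algebra itself, for the twist, and the complex
  numbers, for the counit.\<close>

locale scalar_map =
  fixes \<kappa> :: "complex \<Rightarrow> 'b::ring_1"
  assumes add: "\<kappa> (a + b) = \<kappa> a + \<kappa> b" and mult: "\<kappa> (a * b) = \<kappa> a * \<kappa> b"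
    and one: "\<kappa> 1 = 1" and central: "\<kappa> a * x = x * \<kappa> a"
begin

lemma zero: "\<kappa> 0 = 0"
  using add[of 0 0] by simp

text \<open>The universal property of the free algebra: the algebra homomorphism extending
  \<open>f\<close>.\<close>

definition feval :: "('i gen \<Rightarrow> 'b) \<Rightarrow> 'i free_alg \<Rightarrow> 'b" where
  "feval f a = (\<Sum>w\<in>Poly_Mapping.keys a. \<kappa> (Poly_Mapping.lookup a w) * prod_list (map f (letters w)))"

text \<open>Cancellation can make the support of a sum smaller than the union of the supports.
  Additivity is therefore proved over a common finite index set, where the extra words have
  coefficient 0.\<close>

lemma feval_superset:
  assumes "finite S" "Poly_Mapping.keys a \<subseteq> S"
  shows "feval f a = (\<Sum>w\<in>S. \<kappa> (Poly_Mapping.lookup a w) * prod_list (map f (letters w)))"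
  unfolding feval_def using assms
  by (intro sum.mono_neutral_left) (auto simp: in_keys_iff zero)

lemma feval_add: "feval f (a + b) = feval f a + feval f b"
proof -
  let ?S = "Poly_Mapping.keys a \<union> Poly_Mapping.keys b"
  show ?thesis
    using feval_superset[of ?S a f] feval_superset[of ?S b f] feval_superset[of ?S "a + b" f]
    by (simp add: keys_add lookup_add add sum.distrib algebra_simps)
qed

lemma feval_single: "feval f (Poly_Mapping.single w c) = \<kappa> c * prod_list (map f (letters w))"
  using feval_superset[of "{w}" "Poly_Mapping.single w c" f] by simp

lemma feval_mult: "feval f (a * b) = feval f a * feval f b"
proof (induction a rule: poly_mapping_single_induct)
  case (single v c)
  show ?case
  proof (induction b rule: poly_mapping_single_induct)
    case (single w d)
    have "\<kappa> c * (\<kappa> d * (x * y)) = \<kappa> c * (x * (\<kappa> d * y))" for x y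
      using central[of d x] by (metis mult.assoc)
    then show ?case
      by (simp add: mult_single feval_single plus_free_word_def mult mult.assoc)
  qed (simp add: distrib_left feval_add)
qed (simp add: distrib_right feval_add)

lemma feval_fconst [simp]: "feval f (fconst c) = \<kappa> c"
  by (simp add: fconst_def feval_single zero_free_word_def)

lemma feval_fgen [simp]: "feval f (fgen g) = f g"
  by (simp add: fgen_def feval_single one)

lemma feval_0 [simp]: "feval f 0 = 0" and feval_1 [simp]: "feval f 1 = 1"
  using feval_fconst[of f 0] feval_fconst[of f 1] by (simp_all add: zero one del: feval_fconst)

lemma feval_diff: "feval f (a - b) = feval f a - feval f b"
  using feval_add[of f "a - b" b] by (simp add: algebra_simps)

lemma feval_sum: "feval f (\<Sum>x\<in>A. g x) = (\<Sum>x\<in>A. feval f (g x))"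
  by (induction A rule: infinite_finite_induct) (simp_all add: feval_add)

lemmas feval_hom = feval_add feval_mult feval_diff feval_sum

end

interpretation free: scalar_map fconst
  by unfold_locales (simp_all add: fconst_add fconst_mult, rule fconst_central)

interpretation char: scalar_map "\<lambda>c. c"
  by unfold_locales (simp_all add: mult.commute)

section \<open>The subalgebra generated by the Chevalley generators\<close>

lemma U_fin_ops [simp]:
  "x \<otimes>\<^bsub>U_fin Q\<^esub> y = x \<otimes>\<^bsub>U_res Q\<^esub> y" "x \<oplus>\<^bsub>U_fin Q\<^esub> y = x \<oplus>\<^bsub>U_res Q\<^esub> y"
  by (simp_all add: U_fin_def)

lemma carrier_U_fin_eq:
  "carrier (U_fin Q) = generate_ring (U_res Q)
    (range (scal Q) \<union> {X Q e i | e i. True} \<union> range (H Q) \<union> {qH Q e i | e i. True})"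
  by (simp add: U_fin_def)

lemma U_fin_closed [simp]:
  "scal Q c \<in> carrier (U_fin Q)" "X Q e i \<in> carrier (U_fin Q)"
  "H Q i \<in> carrier (U_fin Q)" "qH Q e i \<in> carrier (U_fin Q)"
  "x \<in> carrier (U_fin Q) \<Longrightarrow> y \<in> carrier (U_fin Q) \<Longrightarrow> x \<otimes>\<^bsub>U_res Q\<^esub> y \<in> carrier (U_fin Q)"
  "x \<in> carrier (U_fin Q) \<Longrightarrow> y \<in> carrier (U_fin Q) \<Longrightarrow> x \<oplus>\<^bsub>U_res Q\<^esub> y \<in> carrier (U_fin Q)"
  unfolding carrier_U_fin_eq
proof -
  let ?G = "range (scal Q) \<union> {X Q e i | e i. True} \<union> range (H Q) \<union> {qH Q e i | e i. True}"
  have "scal Q c \<in> ?G" "X Q e i \<in> ?G" "H Q i \<in> ?G" "qH Q e i \<in> ?G"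
    by auto
  then show "scal Q c \<in> generate_ring (U_res Q) ?G" "X Q e i \<in> generate_ring (U_res Q) ?G"
    "H Q i \<in> generate_ring (U_res Q) ?G" "qH Q e i \<in> generate_ring (U_res Q) ?G"
    by - (rule generate_ring.incl, assumption)+
qed (rule generate_ring.eng_mult generate_ring.eng_add; assumption)+

lemma U_fin_generators_in_U_res:
  "range (scal Q) \<union> {X Q e i | e i. True} \<union> range (H Q) \<union> {qH Q e i | e i. True}
     \<subseteq> carrier (U_res Q)"
  by (auto simp: carrier_U_res scal_def X_def H_def qH_def)

lemma U_fin_subset_U_res: "carrier (U_fin Q) \<subseteq> carrier (U_res Q)"
  unfolding carrier_U_fin_eq
  using ring.generate_ring_in_carrier[OF ring_U_res U_fin_generators_in_U_res] by blast

lemma U_fin_cls: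
  assumes "x \<in> carrier (U_fin Q)"
  obtains a where "x = cls Q a"
  using subsetD[OF U_fin_subset_U_res assms] that unfolding carrier_U_res by blast

text \<open>Scalars belong to the generating set of \<open>U_fin\<close>, so this makes closure
  under negation a special case of closure under products.\<close>

lemma a_inv_U_res:
  assumes "x \<in> carrier (U_res Q)"
  shows "\<ominus>\<^bsub>U_res Q\<^esub> x = scal Q (- 1) \<otimes>\<^bsub>U_res Q\<^esub> x"
proof -
  interpret ring "U_res Q" by (rule ring_U_res)
  obtain a where a: "x = cls Q a" using assms unfolding carrier_U_res by auto
  have z: "cls Q 0 = \<zero>\<^bsub>U_res Q\<^esub>"
    using add.l_cancel_one'[of "cls Q 0" "cls Q 0"] by (simp add: carrier_U_res cls_add)
  show ?thesis
    by (rule minus_equality)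
      (simp_all add: a z scal_def cls_mult cls_add fconst_uminus carrier_U_res)
qed

text \<open>The unit is the scalar 1 and negation is multiplication by the scalar -1, so only
  scalars, generators, sums and products remain. Identities between homomorphisms or
  antihomomorphisms on \<open>U_fin\<close> are thereby reduced to generators.\<close>

lemma U_fin_induct [consumes 1, case_names scal X H qH add mult]:
  assumes "x \<in> carrier (U_fin Q)"
    and scal: "\<And>c. P (scal Q c)" and gens: "\<And>e i. P (X Q e i)" "\<And>i. P (H Q i)" "\<And>e i. P (qH Q e i)"
    and add: "\<And>x y. \<lbrakk>x \<in> carrier (U_fin Q); y \<in> carrier (U_fin Q); P x; P y\<rbrakk> \<Longrightarrow> P (x \<oplus>\<^bsub>U_res Q\<^esub> y)"
    and mult: "\<And>x y. \<lbrakk>x \<in> carrier (U_fin Q); y \<in> carrier (U_fin Q); P x; P y\<rbrakk> \<Longrightarrow> P (x \<otimes>\<^bsub>U_res Q\<^esub> y)"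
  shows "P x"
proof -
  let ?G = "range (scal Q) \<union> {X Q e i | e i. True} \<union> range (H Q) \<union> {qH Q e i | e i. True}"
  have gen: "P y \<and> y \<in> carrier (U_fin Q) \<and> y \<in> carrier (U_res Q)" if "y \<in> ?G" for y
    using that scal gens subsetD[OF U_fin_generators_in_U_res that] by auto
  have "x \<in> generate_ring (U_res Q) ?G" using assms(1) by (simp add: carrier_U_fin_eq)
  then have "P x \<and> x \<in> carrier (U_fin Q)"
  proof induction
    case one
    have "\<one>\<^bsub>U_res Q\<^esub> = scal Q 1" by (simp add: cls_one scal_def)
    then show ?case using scal by simp
  next
    case (a_inv h)
    then have "h \<in> carrier (U_res Q)" using U_fin_subset_U_res by auto
    then show ?case using a_inv scal mult by (simp add: a_inv_U_res)
  qed (use gen add mult in auto)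
  then show ?thesis by simp
qed

section \<open>The twist automorphism\<close>

text \<open>The k-th divided power stands for X_i^k / [k]!, which explains the factor a_i^k.\<close>

definition twist_gen :: "('i \<Rightarrow> complex) \<Rightarrow> ('i \<Rightarrow> complex) \<Rightarrow> 'i gen \<Rightarrow> 'i free_alg" where
  "twist_gen a l g = (case g of
      GX e i k \<Rightarrow> fconst (a i ^ k) * fgen g
    | GH i \<Rightarrow> fgen g + fconst (l i)
    | GQ e i \<Rightarrow> fconst (if e then a i else inverse (a i)) * fgen g)"

definition twist_free :: "('i \<Rightarrow> complex) \<Rightarrow> ('i \<Rightarrow> complex) \<Rightarrow> 'i free_alg \<Rightarrow> 'i free_alg" where
  "twist_free a l = free.feval (twist_gen a l)"

lemma twist_free_fgen [simp]:
  "twist_free a l (fgen (GX e i k)) = fconst (a i ^ k) * fgen (GX e i k)"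
  "twist_free a l (fgen (GH i)) = fgen (GH i) + fconst (l i)"
  "twist_free a l (fgen (GQ e i)) = fconst (if e then a i else inverse (a i)) * fgen (GQ e i)"
  by (simp_all add: twist_free_def twist_gen_def)

lemma twist_free_hom [simp]:
  "twist_free a l (x + y) = twist_free a l x + twist_free a l y"
  "twist_free a l (x * y) = twist_free a l x * twist_free a l y"
  "twist_free a l (x - y) = twist_free a l x - twist_free a l y"
  "twist_free a l (sum f A) = (\<Sum>k\<in>A. twist_free a l (f k))"
  "twist_free a l (fconst c) = fconst c" "twist_free a l 0 = 0" "twist_free a l 1 = 1"
  by (simp_all add: twist_free_def free.feval_hom)

text \<open>Rewriting towards a normal form with a single scalar in front of each word, so that a
  twisted relator can be compared with the relator term by term.\<close>

lemma fconst_left: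
  "fgen g * fconst c = fconst c * fgen g" "fgen g * (fconst c * x) = fconst c * (fgen g * x)"
  "fconst c * (fconst d * x) = fconst (c * d) * x" "fconst c * fconst d = fconst (c * d)"
proof -
  show "fgen g * fconst c = fconst c * fgen g" by (rule fconst_central[symmetric])
  then show "fgen g * (fconst c * x) = fconst c * (fgen g * x)" by (metis mult.assoc)
qed (simp_all add: fconst_mult mult.assoc)

lemmas fconst_normalize = fconst_left mult.assoc distrib_left distrib_right
  left_diff_distrib right_diff_distrib

text \<open>Each relator is an eigenvector of the twist. All its terms have the same degree in each
  index, hence the same power of the a_i, and shifts of H_i are central, so they cancel in
  commutators. Only the commutator of X_i^+ and X_i^- mixes K_i with its inverse and calls for a_i^4
  = 1.\<close>

lemma twist_free_relator:
  assumes a: "\<And>i. a i ^ 4 = 1" and x: "x \<in> relators Q"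
  shows "twist_free a l x \<in> rel_ideal Q"
proof -
  have a0: "a i \<noteq> 0" for i using a[of i] by auto
  have inv2: "inverse (a i) * inverse (a i) = a i * a i" for i
  proof -
    have "(a i * a i) * (a i * a i) = 1" using a[of i] by (simp add: power4_eq_xxxx mult.assoc)
    then show ?thesis using a0[of i] by (simp add: field_simps)
  qed
  have "\<exists>c. twist_free a l x = fconst c * x"
    using x
  proof cases
    case (divided_0 e i)
    have "twist_free a l x = fconst 1 * x"
      by (simp add: divided_0)
    then show ?thesis ..
  next
    case (divided_mult e i k m)
    have "twist_free a l x = fconst (a i ^ (k + m)) * x"
      unfolding divided_mult by (simp add: fconst_normalize power_add mult.commute)
    then show ?thesis ..
  next
    case (H_H i j)
    have "twist_free a l x = fconst 1 * x"
      unfolding H_H by (simp add: fconst_normalize mult.commute)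
    then show ?thesis ..
  next
    case (Q_inverse e i)
    have "twist_free a l x = fconst 1 * x"
      unfolding Q_inverse using a0[of i] by (simp add: fconst_normalize)
    then show ?thesis ..
  next
    case (Q_Q e i e' j)
    have "twist_free a l x =
        fconst ((if e then a i else inverse (a i)) * (if e' then a j else inverse (a j))) * x"
      unfolding Q_Q by (simp add: fconst_normalize mult.commute)
    then show ?thesis ..
  next
    case (Q_H e i j)
    have "twist_free a l x = fconst (if e then a i else inverse (a i)) * x"
      unfolding Q_H by (simp add: fconst_normalize mult.commute)
    then show ?thesis ..
  next
    case (H_X i e j k)
    have "twist_free a l x = fconst (a j ^ k) * x"
      unfolding H_X by (simp add: fconst_normalize mult.commute)
    then show ?thesis ..
  next
    case (Q_X e' i e j k)
    have "twist_free a l x = fconst ((if e' then a i else inverse (a i)) * a j ^ k) * x"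
      unfolding Q_X by (simp add: fconst_normalize mult_ac)
    then show ?thesis ..
  next
    case (X_X i j)
    \<comment> \<open>For i = j the squared exponentials receive a_i^2 and a_i^(-2), which
      \<open>inv2\<close> identifies. For distinct indices the right-hand side of the relation is
      0.\<close>
    have "twist_free a l x = fconst (a i * a j) * x"
      unfolding X_X by (simp add: fconst_normalize inv2 mult_ac)
    then show ?thesis ..
  next
  case (serre i j N e)
    let ?t = "\<lambda>k. fconst ((- 1) ^ k) * fgen (GX e i (N - k)) * fgen (GX e j 1) * fgen (GX e i k)"
    have "twist_free a l (?t k) = fconst (a i ^ N * a j) * ?t k" if "k \<in> {..N}" for k
    proof -
      have "a i ^ (N - k) * a i ^ k = a i ^ N" using that by (simp flip: power_add)
      then have e: "(- 1) ^ k * (a i ^ (N - k) * (a j * a i ^ k)) = a i ^ N * (a j * (- 1) ^ k)"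
        by (simp add: mult_ac)
      show ?thesis by (simp add: fconst_normalize e)
    qed
    then have "(\<Sum>k\<le>N. twist_free a l (?t k)) = (\<Sum>k\<le>N. fconst (a i ^ N * a j) * ?t k)"
      by (intro sum.cong refl)
    then have "twist_free a l x = fconst (a i ^ N * a j) * x"
      by (simp only: serre(1) twist_free_hom(4) sum_distrib_left)
    then show ?thesis ..
  qed
  then show ?thesis using rel_ideal_mult(1)[OF relators_in_rel_ideal[OF x]] by auto
qed

lemma twist_free_rel_ideal:
  assumes "\<And>i. a i ^ 4 = 1" "x \<in> rel_ideal Q"
  shows "twist_free a l x \<in> rel_ideal Q"
  using assms(2)
  by (induction rule: rel_ideal_induct)
    (auto simp: twist_free_relator[OF assms(1)] intro: rel_ideal_0 rel_ideal_add rel_ideal_mult)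

text \<open>The map induced on cosets; \<open>twist_cls\<close> removes the choice of
  representative, because the twist preserves the ideal of relations.\<close>

definition twist :: "'i quantum_data \<Rightarrow> ('i \<Rightarrow> complex) \<Rightarrow> ('i \<Rightarrow> complex) \<Rightarrow>
    'i free_alg set \<Rightarrow> 'i free_alg set" where
  "twist Q a l x = cls Q (twist_free a l (SOME b. cls Q b = x))"

context
  fixes Q :: "'i quantum_data" and a l :: "'i \<Rightarrow> complex"
  assumes a4: "\<And>i. a i ^ 4 = 1"
begin

lemma twist_cls: "twist Q a l (cls Q b) = cls Q (twist_free a l b)"
proof -
  have "cls Q (SOME d. cls Q d = cls Q b) = cls Q b"
    by (rule someI_ex) auto
  then show ?thesis
    using twist_free_rel_ideal[OF a4, where x = "(SOME d. cls Q d = cls Q b) - b" and Q = Q and l = l]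
    unfolding twist_def by (simp add: cls_eq_iff)
qed

lemma twist_gens:
  "twist Q a l (scal Q c) = scal Q c"
  "twist Q a l (X Q e i) = scal Q (a i) \<otimes>\<^bsub>U_res Q\<^esub> X Q e i"
  "twist Q a l (H Q i) = H Q i \<oplus>\<^bsub>U_res Q\<^esub> scal Q (l i)"
  "twist Q a l (qH Q e i) = scal Q (if e then a i else inverse (a i)) \<otimes>\<^bsub>U_res Q\<^esub> qH Q e i"
  by (simp_all add: scal_def X_def H_def qH_def twist_cls cls_mult cls_add)

lemma twist_hom:
  assumes "x \<in> carrier (U_fin Q)" "y \<in> carrier (U_fin Q)"
  shows "twist Q a l (x \<oplus>\<^bsub>U_res Q\<^esub> y) = twist Q a l x \<oplus>\<^bsub>U_res Q\<^esub> twist Q a l y"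
    "twist Q a l (x \<otimes>\<^bsub>U_res Q\<^esub> y) = twist Q a l x \<otimes>\<^bsub>U_res Q\<^esub> twist Q a l y"
  by (rule U_fin_cls[OF assms(1)], rule U_fin_cls[OF assms(2)], simp add: twist_cls cls_mult cls_add)+

lemma twist_closed: "x \<in> carrier (U_fin Q) \<Longrightarrow> twist Q a l x \<in> carrier (U_fin Q)"
  by (induction rule: U_fin_induct) (auto simp: twist_gens twist_hom)

end

lemma fourth_root_inverse:
  fixes z w :: "'a::comm_semiring_1"
  assumes "z * w = 1" "z ^ 4 = 1"
  shows "w ^ 4 = 1"
proof -
  have "z ^ 4 * w ^ 4 = 1" using assms(1) by (simp flip: power_mult_distrib)
  then show ?thesis using assms(2) by simp
qed

lemma twist_inverse:
  assumes a4: "\<And>i. a i ^ 4 = 1" and inv: "\<And>i. a i * b i = 1" "\<And>i. l i + k i = 0"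
    and x: "x \<in> carrier (U_fin Q)"
  shows "twist Q a l (twist Q b k x) = x"
proof -
  have a0: "a i \<noteq> 0" "b i \<noteq> 0" for i using inv(1)[of i] by auto
  have b4: "b i ^ 4 = 1" for i by (rule fourth_root_inverse[OF inv(1) a4])
  have ba: "b i * a i = 1" "inverse (b i) * inverse (a i) = 1" for i
    using inv(1)[of i] by (simp_all add: mult.commute flip: inverse_mult_distrib)
  have lk: "fconst (l i) + fconst (k i) = 0" for i
    by (simp add: inv(2) flip: fconst_add)
  show ?thesis using x
    by (induction rule: U_fin_induct)
      (simp_all add: scal_def X_def H_def qH_def twist_cls[OF a4] twist_cls[OF b4] cls_mult cls_add
        fconst_normalize ba lk add.assoc twist_hom[OF a4] twist_hom[OF b4] twist_closed[OF b4])
qed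

section \<open>Twisting representations and real forms\<close>

lemma scal_central:
  assumes "x \<in> carrier (U_fin Q)"
  shows "x \<otimes>\<^bsub>U_res Q\<^esub> scal Q c = scal Q c \<otimes>\<^bsub>U_res Q\<^esub> x"
  by (rule U_fin_cls[OF assms]) (simp add: scal_def cls_mult fconst_central)

lemma scal_one:
  assumes "x \<in> carrier (U_fin Q)"
  shows "scal Q 1 \<otimes>\<^bsub>U_res Q\<^esub> x = x"
  by (rule U_fin_cls[OF assms]) (simp add: scal_def cls_mult)

lemma scal_scal:
  assumes "x \<in> carrier (U_fin Q)"
  shows "scal Q c \<otimes>\<^bsub>U_res Q\<^esub> (scal Q d \<otimes>\<^bsub>U_res Q\<^esub> x) = scal Q (c * d) \<otimes>\<^bsub>U_res Q\<^esub> x"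
  by (rule U_fin_cls[OF assms]) (simp add: scal_def cls_mult fconst_mult mult.assoc)

lemma add_scal_scal:
  assumes "x \<in> carrier (U_fin Q)"
  shows "x \<oplus>\<^bsub>U_res Q\<^esub> scal Q c \<oplus>\<^bsub>U_res Q\<^esub> scal Q d = x \<oplus>\<^bsub>U_res Q\<^esub> scal Q (c + d)"
    "x \<oplus>\<^bsub>U_res Q\<^esub> scal Q 0 = x"
  by (rule U_fin_cls[OF assms], simp add: scal_def cls_add fconst_add add.assoc)+

text \<open>The relator \<open>H_X\<close> for k = 1. It is what forces X_j to vanish on
  one-dimensional modules.\<close>

lemma H_X_commute:
  "H Q i \<otimes>\<^bsub>U_res Q\<^esub> X Q e j =
   X Q e j \<otimes>\<^bsub>U_res Q\<^esub> H Q i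
     \<oplus>\<^bsub>U_res Q\<^esub> scal Q (of_int (pm e * cartan Q j i)) \<otimes>\<^bsub>U_res Q\<^esub> X Q e j"
  using relators_in_rel_ideal[OF relators.H_X[of i e j 1 Q]]
  by (simp add: H_def X_def scal_def cls_mult cls_add cls_eq_iff diff_diff_add)

lemma qpow_add: "qpow Q (x + y) = qpow Q x * qpow Q y"
  by (simp add: qpow_def algebra_simps add_divide_distrib exp_add)

lemma qpow_minus: "qpow Q (- x) = inverse (qpow Q x)"
  by (simp add: qpow_def exp_minus)

lemma qpow_0 [simp]: "qpow Q 0 = 1"
  by (simp add: qpow_def)

lemma cnj_eq_inverse:
  assumes "(z::complex) ^ 4 = 1"
  shows "cnj z = inverse z"
proof -
  have "norm z = 1" using power_eq_1_iff[OF assms] by simp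
  then have "z * cnj z = 1" by (simp add: complex_norm_square[symmetric])
  then show ?thesis by (simp add: inverse_unique)
qed

lemma repD:
  assumes "rep Q sv \<pi>"
  shows "vector_space sv" "\<pi> (scal Q c) v = sv c v"
    "x \<in> carrier (U_fin Q) \<Longrightarrow> Vector_Spaces.linear sv sv (\<pi> x)"
    "x \<in> carrier (U_fin Q) \<Longrightarrow> y \<in> carrier (U_fin Q) \<Longrightarrow> \<pi> (x \<oplus>\<^bsub>U_res Q\<^esub> y) v = \<pi> x v + \<pi> y v"
    "x \<in> carrier (U_fin Q) \<Longrightarrow> y \<in> carrier (U_fin Q) \<Longrightarrow> \<pi> (x \<otimes>\<^bsub>U_res Q\<^esub> y) v = \<pi> x (\<pi> y v)"
  using assms by (auto simp: rep_def)

lemma rep_scale: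
  "rep Q sv \<pi> \<Longrightarrow> x \<in> carrier (U_fin Q) \<Longrightarrow> \<pi> x (sv c v) = sv c (\<pi> x v)"
  using module_hom.scale[OF repD(3)[unfolded Vector_Spaces.linear_iff_module_hom]] .

text \<open>Keeping the parameters (b, k) of the inverse next to (a, l) makes the situation
  symmetric: interpreting the locale with the two pairs exchanged yields every fact for the inverse
  automorphism.\<close>

locale twist_parameters =
  fixes Q :: "'i quantum_data" and a b l k :: "'i \<Rightarrow> complex"
  assumes a4: "a i ^ 4 = 1" and ab: "a i * b i = 1" and lk: "l i + k i = 0"
begin

lemma b_eq: "b i = inverse (a i)" and k_eq: "k i = - l i"
  using ab[of i] lk[of i] by (simp_all add: inverse_unique eq_neg_iff_add_eq_0 add.commute)

lemma a_nonzero [simp]: "a i \<noteq> 0"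
  using ab[of i] by auto

lemma b4: "b i ^ 4 = 1"
  by (rule fourth_root_inverse[OF ab a4])

lemma twist_parameters_inverse: "twist_parameters b a k l"
  by unfold_locales (rule b4, simp_all add: b_eq k_eq)

abbreviation tw :: "'i free_alg set \<Rightarrow> 'i free_alg set" where "tw \<equiv> twist Q a l"
abbreviation tw_inv :: "'i free_alg set \<Rightarrow> 'i free_alg set" where "tw_inv \<equiv> twist Q b k"

lemmas tw_gens = twist_gens[of a Q l, OF a4] and tw_hom = twist_hom[of a _ Q _ l, OF a4]
  and tw_closed = twist_closed[of a _ Q l, OF a4]
  and tw_tw_inv = twist_inverse[OF a4 ab lk]

lemma rep_twist:
  assumes "rep Q sv \<pi>"
  shows "rep Q sv (\<lambda>x. \<pi> (tw x))"
  using assms by (simp add: rep_def tw_closed tw_hom tw_gens(1))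

text \<open>The adjoint of \<open>tw x\<close> acting through \<pi> is
  \<sigma>(\<open>tw x\<close>), and this has to be \<open>tw\<close> of the new involution applied
  to x; so the new involution is \<open>tw_inv\<close> after \<sigma> after \<open>tw\<close>. The
  shift of H_i cancels because l_i is real.\<close>

lemma real_form_twist:
  assumes real: "\<And>i. cnj (l i) = l i" and \<sigma>: "real_form Q s \<sigma>"
  shows "real_form Q (\<lambda>i. s i * a i ^ 2) (\<lambda>x. tw_inv (\<sigma> (tw x)))"
proof -
  interpret inv: twist_parameters Q b a k l by (rule twist_parameters_inverse)
  have closed: "\<sigma> x \<in> carrier (U_fin Q)" "\<sigma> (\<sigma> x) = x" if "x \<in> carrier (U_fin Q)" for x
    using that \<sigma> by (auto simp: real_form_def)
  have hom: "\<sigma> (x \<oplus>\<^bsub>U_res Q\<^esub> y) = \<sigma> x \<oplus>\<^bsub>U_res Q\<^esub> \<sigma> y"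
    "\<sigma> (x \<otimes>\<^bsub>U_res Q\<^esub> y) = \<sigma> y \<otimes>\<^bsub>U_res Q\<^esub> \<sigma> x"
    if "x \<in> carrier (U_fin Q)" "y \<in> carrier (U_fin Q)" for x y
    using that \<sigma> by (auto simp: real_form_def)
  have gens: "\<sigma> (scal Q c) = scal Q (cnj c)" "\<sigma> (H Q i) = H Q i" "\<sigma> (qH Q e i) = qH Q (\<not> e) i"
    "\<sigma> (X Q e i) = scal Q (s i) \<otimes>\<^bsub>U_res Q\<^esub> X Q (\<not> e) i" for c e i
    using \<sigma> by (auto simp: real_form_def)
  have cnj_a: "cnj (a i) = b i" for i by (simp add: b_eq cnj_eq_inverse a4)
  have bb: "b i * (b i * z) = a i * (a i * z)" for i z
  proof -
    have "(a i * a i) * (a i * a i) = 1" using a4[of i] by (simp add: power4_eq_xxxx mult.assoc)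
    then have "b i * b i = a i * a i" by (simp add: b_eq field_simps)
    then show ?thesis by (simp flip: mult.assoc)
  qed
  \<comment> \<open>The antilinear \<sigma> turns the factor a_i into its conjugate b_i, and
    \<open>tw_inv\<close> contributes another b_i; b_i^2 = a_i^2.\<close>
  have X: "tw_inv (\<sigma> (tw (X Q e i))) = scal Q (s i * a i ^ 2) \<otimes>\<^bsub>U_res Q\<^esub> X Q (\<not> e) i" for e i
    by (simp add: tw_gens inv.tw_gens hom inv.tw_hom gens closed inv.tw_closed scal_central scal_scal
        cnj_a bb power2_eq_square mult_ac)
  \<comment> \<open>Here the factors cancel: \<sigma> conjugates the first one and also exchanges
    the two exponentials, so \<open>tw_inv\<close> contributes the inverse of that
    conjugate.\<close>
  have qH: "tw_inv (\<sigma> (tw (qH Q e i))) = qH Q (\<not> e) i" for e i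
    by (simp add: tw_gens inv.tw_gens hom inv.tw_hom gens closed inv.tw_closed scal_central scal_scal
        cnj_a complex_cnj_inverse b_eq scal_one)
  have H: "tw_inv (\<sigma> (tw (H Q i))) = H Q i" for i
    by (simp add: tw_gens inv.tw_gens hom inv.tw_hom gens closed inv.tw_closed add_scal_scal
        real k_eq)
  show ?thesis
    unfolding real_form_def
    by (simp add: X qH H tw_gens(1) inv.tw_gens(1) gens(1) tw_closed inv.tw_closed closed tw_hom hom
        inv.tw_hom tw_tw_inv inv.tw_tw_inv)
qed

lemma unitary_rep_twist:
  assumes real: "\<And>i. cnj (l i) = l i" and u: "unitary_rep Q s sv \<pi> ip"
  shows "unitary_rep Q (\<lambda>i. s i * a i ^ 2) sv (\<lambda>x. \<pi> (tw x)) ip"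
proof -
  interpret inv: twist_parameters Q b a k l by (rule twist_parameters_inverse)
  obtain \<sigma> where \<sigma>: "real_form Q s \<sigma>"
    and ip: "\<And>x v w. x \<in> carrier (U_fin Q) \<Longrightarrow> ip v (\<pi> x w) = ip (\<pi> (\<sigma> x) v) w"
    using u by (auto simp: unitary_rep_def)
  have "\<sigma> x \<in> carrier (U_fin Q)" if "x \<in> carrier (U_fin Q)" for x
    using that \<sigma> by (auto simp: real_form_def)
  then have "ip v (\<pi> (tw x) w) = ip (\<pi> (tw (tw_inv (\<sigma> (tw x)))) v) w"
    if "x \<in> carrier (U_fin Q)" for x v w
    using that by (simp add: tw_tw_inv tw_closed ip)
  then show ?thesis
    using u real_form_twist[OF real \<sigma>] rep_twist unfolding unitary_rep_def by blast
qed

text \<open>The twist permutes \<open>U_fin\<close>, so the invariant subspaces stay the same, and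
  rescaling X_i keeps the highest weight vector highest. The assumption \<open>a_eq\<close> makes
  the exponentials act on it as required by the shifted weight.\<close>

lemma L_fin_twist:
  assumes a_eq: "\<And>i. a i = qpow Q (of_nat (symm Q i) * l i / 2)" and L: "L_fin Q m sv \<pi>"
  shows "L_fin Q (\<lambda>i. m i + l i) sv (\<lambda>x. \<pi> (tw x))"
proof -
  interpret inv: twist_parameters Q b a k l by (rule twist_parameters_inverse)
  have irr: "irreducible_rep Q sv \<pi>" and rep: "rep Q sv \<pi>"
    using L by (auto simp: L_fin_def irreducible_rep_def)
  interpret vector_space sv using repD(1)[OF rep] .
  obtain v where v: "v \<noteq> 0" "weight_vector Q sv \<pi> m v" "\<And>i. \<pi> (X Q True i) v = 0"
    using L by (auto simp: L_fin_def)
  have "irreducible_rep Q sv (\<lambda>x. \<pi> (tw x))"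
    unfolding irreducible_rep_def
  proof (intro conjI allI impI)
    fix S assume S: "subspace S \<and> (\<forall>x\<in>carrier (U_fin Q). \<pi> (tw x) ` S \<subseteq> S)"
    have "\<pi> x ` S \<subseteq> S" if "x \<in> carrier (U_fin Q)" for x
    proof -
      \<comment> \<open>Surjectivity of the twist: x is the image of
        \<open>tw_inv x\<close>.\<close>
      have "\<pi> (tw (tw_inv x)) ` S \<subseteq> S" using S inv.tw_closed[OF that] by blast
      then show ?thesis by (simp add: tw_tw_inv[OF that])
    qed
    then show "S = {0} \<or> S = UNIV" using irr S unfolding irreducible_rep_def by blast
  qed (use irr rep_twist[OF rep] in \<open>auto simp: irreducible_rep_def\<close>)
  moreover have "weight_vector Q sv (\<lambda>x. \<pi> (tw x)) (\<lambda>i. m i + l i) v"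
    unfolding weight_vector_def
  proof (intro conjI allI)
    show "\<pi> (tw (H Q i)) v = sv (m i + l i) v" for i
      using v(2) by (simp add: tw_gens repD[OF rep] weight_vector_def scale_left_distrib)
    fix e i
    have "of_nat (symm Q i) * l i / 2 + of_nat (symm Q i) * m i / 2 = of_nat (symm Q i) * (m i + l i) / 2"
      by (simp add: algebra_simps add_divide_distrib)
    then show "\<pi> (tw (qH Q e i)) v = sv (qpow Q (of_int (pm e * int (symm Q i)) * (m i + l i) / 2)) v"
      using v(2) by (simp add: tw_gens repD[OF rep] weight_vector_def a_eq pm_def
          qpow_minus[symmetric] qpow_add[symmetric] algebra_simps add_divide_distrib)
  qed
  moreover have "\<pi> (tw (X Q True i)) v = 0" for i
    using v(3) by (simp add: tw_gens repD[OF rep])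
  ultimately show ?thesis using v(1) unfolding L_fin_def by blast
qed

end

section \<open>The counit\<close>

text \<open>The Hopf algebra counit, that is, the trivial module of weight 0. Divided powers of
  order 0 are the unit of the algebra, hence the value 1 there.\<close>

definition counit_gen :: "'i gen \<Rightarrow> complex" where
  "counit_gen g = (case g of GX e i k \<Rightarrow> if k = 0 then 1 else 0 | GH i \<Rightarrow> 0 | GQ e i \<Rightarrow> 1)"

lemma counit_gen_simps [simp]:
  "counit_gen (GX e i k) = (if k = 0 then 1 else 0)" "counit_gen (GH i) = 0"
  "counit_gen (GQ e i) = 1"
  by (simp_all add: counit_gen_def)

lemma counit_rel_ideal: "x \<in> rel_ideal Q \<Longrightarrow> char.feval counit_gen x = 0"
proof (induction rule: rel_ideal_induct)
  case (relator x)
  then show ?case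
    by cases (auto simp: char.feval_hom)
qed (simp_all add: char.feval_hom)

definition counit :: "'i quantum_data \<Rightarrow> 'i free_alg set \<Rightarrow> complex" where
  "counit Q x = char.feval counit_gen (SOME b. cls Q b = x)"

lemma counit_cls: "counit Q (cls Q b) = char.feval counit_gen b"
proof -
  have "cls Q (SOME d. cls Q d = cls Q b) = cls Q b"
    by (rule someI_ex) auto
  then show ?thesis
    using counit_rel_ideal[where x = "(SOME d. cls Q d = cls Q b) - b" and Q = Q]
    unfolding counit_def by (simp add: cls_eq_iff char.feval_hom)
qed

lemma vector_space_complex: "vector_space ((*) :: complex \<Rightarrow> complex \<Rightarrow> complex)"
  by unfold_locales (simp_all add: algebra_simps)

lemma rep_counit: "rep Q (*) (\<lambda>x v. counit Q x * v)"
  unfolding rep_def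
proof (intro conjI ballI allI)
  fix x y v assume xy: "x \<in> carrier (U_fin Q)" "y \<in> carrier (U_fin Q)"
  obtain a b where "x = cls Q a" "y = cls Q b" using U_fin_cls xy by metis
  then show "counit Q (x \<oplus>\<^bsub>U_fin Q\<^esub> y) * v = counit Q x * v + counit Q y * v"
    "counit Q (x \<otimes>\<^bsub>U_fin Q\<^esub> y) * v = counit Q x * (counit Q y * v)"
    by (simp_all add: cls_add cls_mult counit_cls char.feval_hom distrib_right)
next
  show "Vector_Spaces.linear (*) (*) ((*) (counit Q x))" for x
    by unfold_locales (simp_all add: algebra_simps)
qed (simp_all add: vector_space_complex scal_def counit_cls)

lemma subspace_complex:
  assumes "module.subspace (*) (S :: complex set)"
  shows "S = {0} \<or> S = UNIV"
proof (cases "S \<subseteq> {0}")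
  case True
  then show ?thesis
    using module.subspace_0[OF vector_space_complex[folded module_iff_vector_space] assms] by auto
next
  case False
  then obtain z where z: "z \<in> S" "z \<noteq> 0" by auto
  have "(w / z) * z \<in> S" for w
    using module.subspace_scale[OF vector_space_complex[folded module_iff_vector_space] assms z(1)] .
  then show ?thesis using z(2) by auto
qed

lemma L_fin_counit: "L_fin Q (\<lambda>_. 0) (*) (\<lambda>x v. counit Q x * v)"
proof -
  have "irreducible_rep Q (*) (\<lambda>x v. counit Q x * v)"
    unfolding irreducible_rep_def
  proof (intro conjI allI impI)
    show "\<exists>v::complex. v \<noteq> 0" by (rule exI[of _ 1]) simp
  qed (use rep_counit subspace_complex in blast)+
  then show ?thesis
    by (auto simp: L_fin_def weight_vector_def H_def qH_def X_def counit_cls intro!: exI[of _ 1])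
qed

section \<open>Tensor products with one-dimensional modules\<close>

lemma one_dimensional_scale:
  assumes "vector_space sw" "one_dimensional sw \<rho>"
  obtains c where "w = sw c \<rho>"
  using assms module.span_singleton[of sw \<rho>]
  by (auto simp: one_dimensional_def module_iff_vector_space)

text \<open>Every operator on a line is a scalar, so H_i and X_i commute there. Their commutator is
  also A_ii X_i up to sign, and A_ii is nonzero, so X_i acts as 0.\<close>

lemma one_dim_action:
  assumes L: "L_fin Q l sw \<pi>" and one: "one_dimensional sw \<rho>" and cartan: "\<And>i. cartan Q i i \<noteq> 0"
  shows "\<pi> (H Q i) w = sw (l i) w"
    "\<pi> (qH Q e i) w = sw (qpow Q (of_int (pm e * int (symm Q i)) * l i / 2)) w"
    "\<pi> (X Q e i) w = 0"
proof -
  have rep: "rep Q sw \<pi>" using L by (auto simp: L_fin_def irreducible_rep_def)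
  interpret vector_space sw using repD(1)[OF rep] .
  obtain v where v: "v \<noteq> 0" "weight_vector Q sw \<pi> l v"
    using L by (auto simp: L_fin_def)
  obtain c where c: "v = sw c \<rho>" using one_dimensional_scale[OF vector_space_axioms one] .
  obtain d where d: "w = sw d \<rho>" using one_dimensional_scale[OF vector_space_axioms one] .
  \<comment> \<open>The weight vector spans the line, as c = 0 would make it zero; the eigenvalues
    on it are thus those on every vector.\<close>
  have w: "w = sw (d / c) v" using v(1) c d by auto
  have act: "\<pi> x w = sw m w" if "\<pi> x v = sw m v" "x \<in> carrier (U_fin Q)" for x m
    using that by (simp add: w rep_scale[OF rep] mult.commute)
  show H: "\<pi> (H Q i) w = sw (l i) w"
    using v(2) by (intro act) (auto simp: weight_vector_def)
  show "\<pi> (qH Q e i) w = sw (qpow Q (of_int (pm e * int (symm Q i)) * l i / 2)) w"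
    using v(2) by (intro act) (auto simp: weight_vector_def)
  obtain x where x: "\<pi> (X Q e i) \<rho> = sw x \<rho>" using one_dimensional_scale[OF vector_space_axioms one] .
  have X: "\<pi> (X Q e i) w = sw x w" by (simp add: d rep_scale[OF rep] x mult.commute)
  have "\<pi> (H Q i \<otimes>\<^bsub>U_res Q\<^esub> X Q e i) w =
      \<pi> (X Q e i \<otimes>\<^bsub>U_res Q\<^esub> H Q i) w + sw (of_int (pm e * cartan Q i i)) (\<pi> (X Q e i) w)"
    by (simp only: H_X_commute repD[OF rep] U_fin_closed)
  moreover have "\<pi> (H Q i \<otimes>\<^bsub>U_res Q\<^esub> X Q e i) w = \<pi> (X Q e i \<otimes>\<^bsub>U_res Q\<^esub> H Q i) w"
    by (simp add: repD[OF rep] rep_scale[OF rep] H X mult.commute)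
  ultimately have "sw (of_int (pm e * cartan Q i i)) (\<pi> (X Q e i) w) = 0" by simp
  then show "\<pi> (X Q e i) w = 0" using cartan[of i] by (auto simp: pm_def split: if_splits)
qed

section \<open>Transport of modules and inner products along a linear bijection\<close>

lemma L_fin_equivalent:
  assumes L: "L_fin Q m sv \<pi>" and rep': "rep Q st \<pi>'" and J: "Vector_Spaces.linear sv st J" "bij J"
    and int: "\<And>x v. x \<in> carrier (U_fin Q) \<Longrightarrow> \<pi>' x (J v) = J (\<pi> x v)"
  shows "L_fin Q m st \<pi>'"
proof -
  interpret J: Vector_Spaces.linear sv st J by fact
  have irr: "irreducible_rep Q sv \<pi>"
    using L by (auto simp: L_fin_def)
  obtain v where v: "v \<noteq> 0" "weight_vector Q sv \<pi> m v" "\<And>i. \<pi> (X Q True i) v = 0"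
    using L by (auto simp: L_fin_def)
  have Jv: "J v \<noteq> 0" using v(1) J(2) J.zero by (metis bij_pointE)
  have "irreducible_rep Q st \<pi>'"
    unfolding irreducible_rep_def
  proof (intro conjI allI impI)
    fix S assume S: "module.subspace st S \<and> (\<forall>x\<in>carrier (U_fin Q). \<pi>' x ` S \<subseteq> S)"
    have "J.vs1.subspace (J -` S)" using S J.subspace_vimage by blast
    moreover have "\<pi> x ` (J -` S) \<subseteq> J -` S" if "x \<in> carrier (U_fin Q)" for x
    proof
      fix u assume "u \<in> \<pi> x ` (J -` S)"
      then obtain w where w: "J w \<in> S" "u = \<pi> x w" by auto
      then have "\<pi>' x (J w) \<in> S" using S that by blast
      then show "u \<in> J -` S" by (simp add: w int[OF that])
    qed
    ultimately have "J -` S = {0} \<or> J -` S = UNIV"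
      using irr unfolding irreducible_rep_def by blast
    moreover have "S = J ` (J -` S)" using J(2) by (simp add: bij_def surj_image_vimage_eq)
    moreover have "J ` {0} = {0}" "range J = UNIV" using J(2) by (simp_all add: bij_def J.zero)
    ultimately show "S = {0} \<or> S = UNIV" by metis
  qed (use rep' Jv in auto)
  moreover have "weight_vector Q st \<pi>' m (J v)"
    using v(2) by (simp add: weight_vector_def int J.scale)
  moreover have "\<pi>' (X Q True i) (J v) = 0" for i
    by (simp add: int v(3) J.zero)
  ultimately show ?thesis using Jv unfolding L_fin_def by blast
qed

lemma linear_inv_into:
  assumes J: "Vector_Spaces.linear sv st J" "bij J"
  shows "Vector_Spaces.linear st sv (inv_into UNIV J)"
proof -
  interpret J: Vector_Spaces.linear sv st J by fact
  have inv_J: "inv_into UNIV J (J v) = v" for v using J(2) by (simp add: bij_def)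
  have J_inv: "J (inv_into UNIV J v) = v" for v using J(2) by (simp add: bij_def surj_f_inv_f)
  show ?thesis
  proof unfold_locales
    fix u w c
    show "inv_into UNIV J (u + w) = inv_into UNIV J u + inv_into UNIV J w"
      by (metis J.add J_inv inv_J)
    show "inv_into UNIV J (st c u) = sv c (inv_into UNIV J u)"
      by (metis J.scale J_inv inv_J)
  qed
qed

lemma unitary_rep_equivalent:
  assumes u: "unitary_rep Q s sv \<pi> ip" and rep': "rep Q st \<pi>'"
    and J: "Vector_Spaces.linear sv st J" "bij J"
    and int: "\<And>x v. x \<in> carrier (U_fin Q) \<Longrightarrow> \<pi>' x (J v) = J (\<pi> x v)"
  shows "unitary_rep Q s st \<pi>' (\<lambda>u w. ip (inv_into UNIV J u) (inv_into UNIV J w))"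
proof -
  interpret J: Vector_Spaces.linear sv st J by fact
  have inv_J: "inv_into UNIV J (J v) = v" for v using J(2) by (simp add: bij_def)
  have J_inv: "J (inv_into UNIV J v) = v" for v using J(2) by (simp add: bij_def surj_f_inv_f)
  interpret I: Vector_Spaces.linear st sv "inv_into UNIV J" by (rule linear_inv_into[OF J])
  have nonzero: "inv_into UNIV J u \<noteq> 0" if "u \<noteq> 0" for u using that J_inv J.zero by metis
  have int': "inv_into UNIV J (\<pi>' x u) = \<pi> x (inv_into UNIV J u)" if "x \<in> carrier (U_fin Q)" for x u
    using int[OF that, of "inv_into UNIV J u"] by (simp add: J_inv inv_J)
  obtain \<sigma> where \<sigma>: "real_form Q s \<sigma>"
    and ip: "\<And>x v w. x \<in> carrier (U_fin Q) \<Longrightarrow> ip v (\<pi> x w) = ip (\<pi> (\<sigma> x) v) w"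
    using u by (auto simp: unitary_rep_def)
  have closed: "\<sigma> x \<in> carrier (U_fin Q)" if "x \<in> carrier (U_fin Q)" for x
    using that \<sigma> by (auto simp: real_form_def)
  have "hermitian_inner_product st (\<lambda>u w. ip (inv_into UNIV J u) (inv_into UNIV J w))"
  proof -
    have ip: "hermitian_inner_product sv ip" using u by (simp add: unitary_rep_def)
    then have "(\<forall>u v w. ip u (v + w) = ip u v + ip u w)" "(\<forall>c v w. ip v (sv c w) = c * ip v w)"
      "(\<forall>v w. ip w v = cnj (ip v w))" "(\<forall>v. v \<noteq> 0 \<longrightarrow> 0 < Re (ip v v))"
      unfolding hermitian_inner_product_def by - (elim conjE, assumption)+
    then show ?thesis
      unfolding hermitian_inner_product_def I.add I.scale using nonzero by (intro conjI allI impI; meson)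
  qed
  moreover have "ip (inv_into UNIV J u) (inv_into UNIV J (\<pi>' x w)) =
      ip (inv_into UNIV J (\<pi>' (\<sigma> x) u)) (inv_into UNIV J w)"
    if "x \<in> carrier (U_fin Q)" for x u w
    by (simp add: int' that closed ip)
  ultimately show ?thesis using \<sigma> rep' unfolding unitary_rep_def by blast
qed

text \<open>Since {\<rho>} is a basis of the line, tensoring with \<rho> carries a basis of the
  first factor bijectively onto a basis of the tensor product.\<close>

lemma tensor_product_iso:
  assumes V: "vector_space sv" and W: "vector_space sw" and one: "one_dimensional sw \<rho>"
    and t: "tensor_product sv sw st t"
  shows "Vector_Spaces.linear sv st (\<lambda>v. t v \<rho>)" "bij (\<lambda>v. t v \<rho>)"
proof -
  interpret V: vector_space sv by fact
  interpret W: vector_space sw by fact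
  show lin: "Vector_Spaces.linear sv st (\<lambda>v. t v \<rho>)" using t by (simp add: tensor_product_def)
  interpret J: Vector_Spaces.linear sv st "\<lambda>v. t v \<rho>" by fact
  obtain S where "V.independent S" "UNIV \<subseteq> V.span S"
    by (rule V.basis_exists[of UNIV])
  then have S: "V.independent S" "V.span S = UNIV" by auto
  have "W.independent {\<rho>}" using one by (simp add: one_dimensional_def)
  then have "is_basis sw {\<rho>}" using one by (simp add: is_basis_def one_dimensional_def)
  moreover have "is_basis sv S" using S by (simp add: is_basis_def)
  ultimately have "inj_on (\<lambda>(v, w). t v w) (S \<times> {\<rho>}) \<and> is_basis st ((\<lambda>(v, w). t v w) ` (S \<times> {\<rho>}))"
    using t unfolding tensor_product_def by blast
  moreover have "(\<lambda>(v, w). t v w) ` (S \<times> {\<rho>}) = (\<lambda>v. t v \<rho>) ` S" by auto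
  ultimately have inj: "inj_on (\<lambda>v. t v \<rho>) S"
    and ind: "J.vs2.independent ((\<lambda>v. t v \<rho>) ` S)" and span: "J.vs2.span ((\<lambda>v. t v \<rho>) ` S) = UNIV"
    by (auto simp: inj_on_def is_basis_def)
  show "bij (\<lambda>v. t v \<rho>)"
    unfolding bij_def
    using J.inj_on_span_independent_image[OF ind inj] J.span_image[of S] span S(2) by simp
qed

text \<open>The first factor is itself a model of its tensor product with a line: v tensor w is v
  multiplied by the coordinate of w with respect to \<rho>. This supplies the map \<open>t\<close>
  when a given module is recognized as a tensor product.\<close>

lemma tensor_product_one_dim:
  fixes su :: "complex \<Rightarrow> 'u \<Rightarrow> 'u::ab_group_add"
  assumes U: "vector_space su" and W: "vector_space sw" and one: "one_dimensional sw \<rho>"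
  defines "t \<equiv> \<lambda>v w. su (THE c. w = sw c \<rho>) v"
  shows "tensor_product su sw su t" "t v (sw c \<rho>) = su c v"
proof -
  interpret U: vector_space su by fact
  interpret W: vector_space sw by fact
  have \<rho>: "\<rho> \<noteq> 0" using one by (simp add: one_dimensional_def)
  show t: "t v (sw c \<rho>) = su c v" for v c
    using \<rho> by (simp add: t_def)
  have ex: "\<exists>c. w = sw c \<rho>" for w using one_dimensional_scale[OF W one] by metis
  have lin1: "Vector_Spaces.linear su su (\<lambda>v. t v w)" for w
    using ex[of w] by unfold_locales (auto simp: t U.scale_right_distrib mult.commute)
  have lin2: "Vector_Spaces.linear sw su (t v)" for v
  proof unfold_locales
    fix b1 b2 r
    obtain c d where cd: "b1 = sw c \<rho>" "b2 = sw d \<rho>" using ex by metis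
    show "t v (b1 + b2) = t v b1 + t v b2"
      by (simp add: cd t U.scale_left_distrib flip: W.scale_left_distrib)
    show "t v (sw r b1) = su r (t v b1)" by (simp add: cd t)
  qed
  have "inj_on (\<lambda>(v, w). t v w) (S \<times> R) \<and> is_basis su ((\<lambda>(v, w). t v w) ` (S \<times> R))"
    if S: "is_basis su S" and R: "is_basis sw R" for S R
  proof -
    have "W.independent {\<rho>}" "W.span {\<rho>} = UNIV" using one by (simp_all add: one_dimensional_def)
    \<comment> \<open>Comparing cardinalities of bases shows that an arbitrary basis
      \<open>R\<close> of the line is a single vector, nonzero by independence; the products with
      \<open>S\<close> are then a nonzero multiple of \<open>S\<close>.\<close>
    then have "W.dim UNIV = card {\<rho>}" by (intro W.dim_eq_card) auto
    moreover have "W.dim UNIV = card R"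
      using R by (intro W.dim_eq_card) (auto simp: is_basis_def)
    ultimately obtain w where w: "R = {w}" by (auto simp: card_1_singleton_iff)
    obtain c where c: "w = sw c \<rho>" using ex by metis
    have c0: "c \<noteq> 0" using R w c W.dependent_zero[of R] by (auto simp: is_basis_def)
    interpret J: Vector_Spaces.linear su su "su c"
      by unfold_locales (simp_all add: U.scale_right_distrib mult.commute)
    have inj: "inj (su c)" using c0 by (rule U.injective_scale)
    have surj: "range (su c) = UNIV"
      by (rule surjI[of _ "su (inverse c)"]) (simp add: c0)
    have im: "(\<lambda>(v, w). t v w) ` (S \<times> R) = su c ` S"
    proof -
      have "S \<times> {w} = (\<lambda>v. (v, w)) ` S" by auto
      then show ?thesis by (simp add: w image_image) (simp add: c t)
    qed
    have "U.independent (su c ` S)"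
      using S inj by (intro J.independent_injective_image) (auto simp: is_basis_def inj_on_def)
    moreover have "U.span (su c ` S) = UNIV"
      using S surj J.span_image[of S] by (simp add: is_basis_def)
    moreover have "inj_on (\<lambda>(v, w). t v w) (S \<times> R)"
      using inj by (auto simp: inj_on_def w c t)
    ultimately show ?thesis by (simp add: im is_basis_def)
  qed
  then show "tensor_product su sw su t"
    by (simp add: tensor_product_def U lin1 lin2)
qed

lemma rep_transport:
  assumes rep: "rep Q sv \<pi>" and J: "Vector_Spaces.linear sv st J" "bij J"
  shows "rep Q st (\<lambda>x u. J (\<pi> x (inv_into UNIV J u)))"
proof -
  interpret J: Vector_Spaces.linear sv st J by fact
  have inv_J: "inv_into UNIV J (J v) = v" for v using J(2) by (simp add: bij_def)
  have J_inv: "J (inv_into UNIV J v) = v" for v using J(2) by (simp add: bij_def surj_f_inv_f)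
  interpret I: Vector_Spaces.linear st sv "inv_into UNIV J" by (rule linear_inv_into[OF J])
  show ?thesis
    unfolding rep_def
  proof (intro conjI ballI allI)
    show "vector_space st" ..
    fix x assume x: "x \<in> carrier (U_fin Q)"
    interpret \<pi>: Vector_Spaces.linear sv sv "\<pi> x" using repD(3)[OF rep x] .
    show "Vector_Spaces.linear st st (\<lambda>u. J (\<pi> x (inv_into UNIV J u)))"
      by unfold_locales (simp_all add: I.add I.scale \<pi>.add \<pi>.scale J.add J.scale)
  qed (simp_all add: repD[OF rep] inv_J J_inv J.add J.scale)
qed

section \<open>The coproduct action as a twist\<close>

context twist_parameters
begin

text \<open>The coproduct prescribes the action only on generators; since X_i kills \<rho> and the
  exponentials scale it, the prescription says that v -> v tensor \<rho> intertwines the twisted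
  action on generators. Induction over \<open>U_fin\<close> extends this to all elements.
  Conversely, every w is a multiple of \<rho>.\<close>

lemma tensor_rep_iff:
  assumes a_eq: "\<And>i. a i = qpow Q (of_nat (symm Q i) * l i / 2)"
    and cartan: "\<And>i. cartan Q i i \<noteq> 0"
    and Lr: "L_fin Q l sw \<pi>r" and one: "one_dimensional sw \<rho>"
    and rep: "rep Q sv \<pi>" and rep_t: "rep Q st \<pi>t" and t: "tensor_product sv sw st t"
  shows "tensor_rep Q st t \<pi> \<pi>r \<pi>t \<longleftrightarrow>
    (\<forall>x\<in>carrier (U_fin Q). \<forall>v. \<pi>t x (t v \<rho>) = t (\<pi> (tw x) v) \<rho>)" (is "?L \<longleftrightarrow> ?R")
proof -
  have rep_r: "rep Q sw \<pi>r" using Lr by (auto simp: L_fin_def irreducible_rep_def)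
  interpret W: vector_space sw using repD(1)[OF rep_r] .
  interpret T: vector_space st using repD(1)[OF rep_t] .
  interpret R: Vector_Spaces.linear sw st "t v" for v using t by (simp add: tensor_product_def)
  interpret L: Vector_Spaces.linear sv st "\<lambda>v. t v w" for w using t by (simp add: tensor_product_def)
  note act = one_dim_action(1,3)[OF Lr one cartan]
  have act_qH: "\<pi>r (qH Q e i) w = sw (if e then a i else inverse (a i)) w" for e i w
    by (simp add: one_dim_action(2)[OF Lr one cartan] a_eq pm_def qpow_minus)
  show ?thesis
  proof
    assume tr: ?L
    show ?R
    proof (intro ballI allI)
      fix x v assume "x \<in> carrier (U_fin Q)"
      then show "\<pi>t x (t v \<rho>) = t (\<pi> (tw x) v) \<rho>"
      proof (induction arbitrary: v rule: U_fin_induct)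
        case (X e i)
        show ?case using tr
          by (simp add: tensor_rep_def act act_qH R.scale R.zero L.scale tw_gens repD[OF rep])
      next
        case (H i)
        show ?case using tr
          by (simp add: tensor_rep_def act R.scale L.scale L.add tw_gens repD[OF rep])
      next
        case (qH e i)
        show ?case using tr
          by (simp add: tensor_rep_def act_qH R.scale L.scale tw_gens repD[OF rep])
      qed (simp_all add: repD[OF rep] repD[OF rep_t] tw_hom tw_closed L.add tw_gens L.scale)
    qed
  next
    assume tr: ?R
    note tw_act = tr[rule_format]
    show ?L
      unfolding tensor_rep_def
    proof (intro conjI allI)
      fix i v w
      obtain c where c: "w = sw c \<rho>" using one_dimensional_scale[OF W.vector_space_axioms one] .
      show "\<pi>t (H Q i) (t v w) = t (\<pi> (H Q i) v) w + t v (\<pi>r (H Q i) w)"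
        by (simp add: c act R.scale rep_scale[OF rep_t] tw_act tw_gens repD[OF rep] L.add L.scale
            T.scale_right_distrib mult.commute)
      fix e
      show "\<pi>t (qH Q e i) (t v w) = t (\<pi> (qH Q e i) v) (\<pi>r (qH Q e i) w)"
        by (simp add: c act_qH R.scale rep_scale[OF rep_t] tw_act tw_gens repD[OF rep] L.scale
            mult.commute)
      show "\<pi>t (X Q e i) (t v w) =
          t (\<pi> (X Q e i) v) (\<pi>r (qH Q True i) w) + t (\<pi> (qH Q False i) v) (\<pi>r (X Q e i) w)"
        by (simp add: c act act_qH R.scale R.zero rep_scale[OF rep_t] tw_act tw_gens repD[OF rep]
            L.scale mult.commute)
    qed (rule rep_t)
  qed
qed

end

section \<open>Weights of one-dimensional modules\<close>

text \<open>The function \<open>qpow Q\<close> has period m/n, and the exponent is p times half of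
  it.\<close>

lemma qpow_square_half_period:
  assumes "0 < qnum Q" "0 < qden Q"
  shows "qpow Q (of_nat (qden Q) / (2 * of_nat (qnum Q)) * of_int p) = exp (of_real pi * \<i> * of_int p)"
  using assms by (simp add: qpow_def field_simps)

lemma qpow_half_square: "qpow Q (x / 2) ^ 2 = qpow Q x"
  by (simp add: power2_eq_square flip: qpow_add)

lemma exp_pi_i_int_square: "exp (of_real pi * \<i> * of_int p) ^ 2 = 1"
proof -
  have "exp (of_real pi * \<i> * of_int p) ^ 2 = cis (pi * of_int p) ^ 2"
    by (simp add: cis_conv_exp mult_ac)
  also have "\<dots> = cis (2 * pi * of_int p)"
    by (simp add: DeMoivre mult_ac)
  finally show ?thesis by (simp add: cis_multiple_2pi)
qed

text \<open>q^(d_i m) = 1 gives [m] = 0, so the minimum is taken over a nonempty set. Positivity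
  permits division by M_i when solving for r_i.\<close>

lemma qorder_pos:
  assumes "0 < qnum Q" "0 < qden Q"
  shows "0 < qorder Q i"
proof -
  have "qpow Q (of_nat (symm Q i) * of_nat (qden Q)) = 1"
    using assms cis_multiple_2pi[of "of_nat (qnum Q * symm Q i)"]
    by (simp add: qpow_def cis_conv_exp mult_ac)
  then have "qint Q i (of_nat (qden Q)) = 0" by (simp add: qint_def qpow_minus)
  then show ?thesis
    using LeastI[of "\<lambda>k. 0 < k \<and> qint Q i (of_nat k) = 0" "qden Q"] assms(2)
    unfolding qorder_def by blast
qed

section \<open>Pairings of weights with coroots\<close>

context simple_lie_weight_data
begin

lemma simple_root_weight: "\<alpha> i \<in> weight_space sg h"
  using simple_roots by (auto simp: simple_roots_def roots_def)

lemma norm_nonzero: "B (\<alpha> i) (\<alpha> i) \<noteq> 0"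
  using symm_eq[of i] symm_pos[of i] by auto

lemma cartan_diag: "cartan Q i i \<noteq> 0"
proof -
  have "(of_int (cartan Q i i) :: complex) = 2" using cartan_eq[of i i] norm_nonzero by simp
  then show ?thesis by auto
qed

lemma weight_space_add: "f \<in> weight_space sg h \<Longrightarrow> g \<in> weight_space sg h \<Longrightarrow> add_weight f g \<in> weight_space sg h"
  by (auto simp: weight_space_def add_weight_def algebra_simps)

lemma weight_space_scale: "f \<in> weight_space sg h \<Longrightarrow> (\<lambda>x. c * f x) \<in> weight_space sg h"
  by (auto simp: weight_space_def algebra_simps)

lemma form_add:
  "f \<in> weight_space sg h \<Longrightarrow> g \<in> weight_space sg h \<Longrightarrow>
   B (add_weight f g) (\<alpha> i) = B f (\<alpha> i) + B g (\<alpha> i)"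
  using invariant_form simple_root_weight[of i]
  unfolding invariant_weight_form_def add_weight_def by blast

lemma form_scale: "f \<in> weight_space sg h \<Longrightarrow> B (\<lambda>x. c * f x) (\<alpha> i) = c * B f (\<alpha> i)"
  using invariant_form simple_root_weight[of i] unfolding invariant_weight_form_def by blast

lemma coroot_pairing_add:
  "f \<in> weight_space sg h \<Longrightarrow> g \<in> weight_space sg h \<Longrightarrow>
   coroot_pairing B \<alpha> (add_weight f g) = (\<lambda>i. coroot_pairing B \<alpha> f i + coroot_pairing B \<alpha> g i)"
  by (simp add: coroot_pairing_def form_add fun_eq_iff distrib_left add_divide_distrib)

lemma coroot_pairing_scale:
  "f \<in> weight_space sg h \<Longrightarrow> coroot_pairing B \<alpha> (\<lambda>x. c * f x) i = c * coroot_pairing B \<alpha> f i"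
  by (simp add: coroot_pairing_def form_scale)

text \<open>The form is known to be additive on the weight space only, so membership has to be
  carried through the induction together with the pairing.\<close>

lemma partial_lincomb:
  assumes "finite A"
  shows "(\<lambda>x. \<Sum>i\<in>A. c i * \<Lambda> i x) \<in> weight_space sg h \<and>
    coroot_pairing B \<alpha> (\<lambda>x. \<Sum>i\<in>A. c i * \<Lambda> i x) j = (if j \<in> A then c j else 0)"
  using assms
proof (induction A)
  case empty
  show ?case
    \<comment> \<open>The empty sum is treated as 0 times a fundamental weight.\<close>
    using coroot_pairing_scale[OF fundamental_weight, of 0] weight_space_scale[OF fundamental_weight, of 0]
    by simp
next
  case (insert i A)
  have "(\<lambda>x. \<Sum>i\<in>insert i A. c i * \<Lambda> i x) =
      add_weight (\<lambda>x. c i * \<Lambda> i x) (\<lambda>x. \<Sum>i\<in>A. c i * \<Lambda> i x)"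
    using insert by (simp add: add_weight_def)
  then show ?case
    using insert weight_space_scale[OF fundamental_weight, of "c i" i]
    by (auto simp: weight_space_add coroot_pairing_add coroot_pairing_scale fundamental_weight
        fundamental_weight_pairing)
qed

lemma lincomb_weight: "lincomb c \<Lambda> \<in> weight_space sg h"
  and coroot_pairing_lincomb: "coroot_pairing B \<alpha> (lincomb c \<Lambda>) = c"
  using partial_lincomb[of UNIV c] by (auto simp: lincomb_def fun_eq_iff)

text \<open>Multiplication by d_i cancels the d_i in the denominator, leaving the exponent m p_i /
  (2n), half a period times p_i. The three facts give s_i, a_i^2 = s_i and a_i^4 = 1.\<close>

lemma half_period_weight:
  assumes q: "0 < qnum Q" "0 < qden Q"
    and r: "of_rat (r i) * of_nat (qorder Q i) =
      of_nat (qden Q) / (2 * of_nat (qnum Q) * of_nat (symm Q i)) * (of_int (p i) :: complex)"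
  shows "qpow Q (of_nat (symm Q i) * (of_nat (qorder Q i) * of_rat (r i)))
      = exp (of_real pi * \<i> * of_int (p i))"
    "qpow Q (of_nat (symm Q i) * (of_rat (r i) * of_nat (qorder Q i)) / 2) ^ 2
      = exp (of_real pi * \<i> * of_int (p i))"
    "qpow Q (of_nat (symm Q i) * (of_rat (r i) * of_nat (qorder Q i)) / 2) ^ 4 = 1"
proof -
  have "of_nat (symm Q i) * (of_rat (r i) * of_nat (qorder Q i)) =
      of_nat (qden Q) / (2 * of_nat (qnum Q)) * (of_int (p i) :: complex)"
    unfolding r using symm_pos[of i] by simp
  then have *: "qpow Q (of_nat (symm Q i) * (of_rat (r i) * of_nat (qorder Q i)))
      = exp (of_real pi * \<i> * of_int (p i))"
    using qpow_square_half_period[OF q] by simp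
  then show "qpow Q (of_nat (symm Q i) * (of_nat (qorder Q i) * of_rat (r i)))
      = exp (of_real pi * \<i> * of_int (p i))"
    by (simp only: mult.commute[of "of_rat (r i)"])
  show **: "qpow Q (of_nat (symm Q i) * (of_rat (r i) * of_nat (qorder Q i)) / 2) ^ 2
      = exp (of_real pi * \<i> * of_int (p i))"
    unfolding *[symmetric] by (rule qpow_half_square)
  have four: "z ^ 4 = (z ^ 2) ^ 2" for z :: complex by (simp flip: power_mult)
  show "qpow Q (of_nat (symm Q i) * (of_rat (r i) * of_nat (qorder Q i)) / 2) ^ 4 = 1"
    by (simp only: four ** exp_pi_i_int_square)
qed

lemma one_dim_rep_parameters:
  assumes q: "0 < qnum Q" "0 < qden Q"
    and od: "one_dim_rep Q B \<alpha> \<Lambda> p r lam\<^sub>r s sw \<pi>\<^sub>r \<rho>"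
  defines "l \<equiv> coroot_pairing B \<alpha> lam\<^sub>r"
  defines "a \<equiv> \<lambda>i. qpow Q (of_nat (symm Q i) * l i / 2)"
  shows "lam\<^sub>r \<in> weight_space sg h" "cnj (l i) = l i" "s i = a i ^ 2" "s i = 1 \<or> s i = - 1"
    "a i ^ 4 = 1" "L_fin Q l sw \<pi>\<^sub>r" "one_dimensional sw \<rho>"
proof -
  have r: "of_rat (r i) * of_nat (qorder Q i) =
      of_nat (qden Q) / (2 * of_nat (qnum Q) * of_nat (symm Q i)) * (of_int (p i) :: complex)"
    and lam: "lam\<^sub>r = lincomb (\<lambda>i. of_rat (r i) * of_nat (qorder Q i)) \<Lambda>"
    and s: "s i = qpow Q (of_nat (symm Q i) * (of_nat (qorder Q i) * of_rat (r i)))" for i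
    using od by (auto simp: one_dim_rep_def)
  have l: "l = (\<lambda>i. of_rat (r i) * of_nat (qorder Q i))"
    unfolding l_def lam by (rule coroot_pairing_lincomb)
  note hp = half_period_weight[OF q, of r _ p, OF r, folded s]
  show "lam\<^sub>r \<in> weight_space sg h" unfolding lam by (rule lincomb_weight)
  show "cnj (l i) = l i" unfolding l r by simp
  show "s i = a i ^ 2" "a i ^ 4 = 1" using hp[of i] by (simp_all add: a_def l)
  show "s i = 1 \<or> s i = - 1"
    using exp_pi_i_int_square[of "p i"] by (simp add: hp(1) power2_eq_1_iff)
  show "L_fin Q l sw \<pi>\<^sub>r" "one_dimensional sw \<rho>"
    using od by (auto simp: one_dim_rep_def l_def)
qed

text \<open>Twisting the trivial module gives a line of any weight whose parameters satisfy a_i^4 =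
  1; it remains to choose a weight with the prescribed signs.\<close>

lemma one_dim_rep_exists:
  assumes q: "0 < qnum Q" "0 < qden Q" and s: "\<And>i. s i = 1 \<or> s i = - 1"
  shows "\<exists>p r lam\<^sub>r \<pi>\<^sub>r. one_dim_rep Q B \<alpha> \<Lambda> p r lam\<^sub>r s (*) \<pi>\<^sub>r (1::complex)"
proof -
  \<comment> \<open>The sign is e^(pi i p_i), so the parity of p_i is all that matters; r_i below is
    then solved from r_i M_i = m p_i / (2 n d_i).\<close>
  define p :: "'i \<Rightarrow> int" where "p i = (if s i = 1 then 0 else 1)" for i
  define r :: "'i \<Rightarrow> rat" where "r i = of_nat (qden Q) * of_int (p i) /
    (2 * of_nat (qnum Q) * of_nat (symm Q i) * of_nat (qorder Q i))" for i
  define l :: "'i \<Rightarrow> complex" where "l i = of_rat (r i) * of_nat (qorder Q i)" for i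
  define a where "a i = qpow Q (of_nat (symm Q i) * l i / 2)" for i
  have r: "of_rat (r i) * of_nat (qorder Q i) =
      of_nat (qden Q) / (2 * of_nat (qnum Q) * of_nat (symm Q i)) * (of_int (p i) :: complex)" for i
    using q symm_pos[of i] qorder_pos[OF q, of i]
    by (simp add: r_def of_rat_divide of_rat_mult)
  note hp = half_period_weight[OF q, of r _ p, OF r]
  have a4: "a i ^ 4 = 1" for i using hp(3)[of i] by (simp add: a_def l_def)
  have a0: "a i \<noteq> 0" for i using a4[of i] by auto
  interpret T: twist_parameters Q a "\<lambda>i. inverse (a i)" l "\<lambda>i. - l i"
    by unfold_locales (simp_all add: a4 a0)
  have pairing: "coroot_pairing B \<alpha> (lincomb l \<Lambda>) = l" by (rule coroot_pairing_lincomb)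
  have L: "L_fin Q l (*) (\<lambda>x v. counit Q (T.tw x) * v)"
    using T.L_fin_twist[OF a_def L_fin_counit] by simp
  have "qpow Q (of_nat (symm Q i) * (of_nat (qorder Q i) * of_rat (r i))) = s i" for i
    using s[of i] by (auto simp: hp(1) p_def)
  moreover have "one_dimensional (*) (1::complex)"
    using module.span_singleton[OF vector_space_complex[folded module_iff_vector_space], of 1]
    by (simp add: one_dimensional_def)
  moreover have "lincomb l \<Lambda> = lincomb (\<lambda>i. of_rat (r i) * of_nat (qorder Q i)) \<Lambda>"
    by (simp add: l_def[abs_def])
  ultimately have "one_dim_rep Q B \<alpha> \<Lambda> p r (lincomb l \<Lambda>) s (*) (\<lambda>x v. counit Q (T.tw x) * v) 1"
    unfolding one_dim_rep_def using r L pairing by auto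
  then show ?thesis by blast
qed

section \<open>Both directions for a fixed one-dimensional module\<close>

context
  fixes p :: "'i \<Rightarrow> int" and r :: "'i \<Rightarrow> rat" and lam\<^sub>r :: "'g \<Rightarrow> complex" and s :: "'i \<Rightarrow> complex"
    and sw :: "complex \<Rightarrow> 'w \<Rightarrow> 'w::ab_group_add" and \<pi>\<^sub>r \<rho>
  assumes q: "0 < qnum Q" "0 < qden Q"
    and one_dim: "one_dim_rep Q B \<alpha> \<Lambda> p r lam\<^sub>r s sw \<pi>\<^sub>r \<rho>"
begin

abbreviation (input) lr :: "'i \<Rightarrow> complex" where "lr \<equiv> coroot_pairing B \<alpha> lam\<^sub>r"
abbreviation (input) ar :: "'i \<Rightarrow> complex" where
  "ar \<equiv> \<lambda>i. qpow Q (of_nat (symm Q i) * lr i / 2)"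

private lemmas par = one_dim_rep_parameters[OF q one_dim]

interpretation T: twist_parameters Q ar "\<lambda>i. inverse (ar i)" lr "\<lambda>i. - lr i"
proof
  have "ar i \<noteq> 0" for i using par(5)[of i] by (auto simp: power_0_left)
  then show "ar i * inverse (ar i) = 1" for i by simp
qed (simp_all add: par(5))

private lemma rep_r: "rep Q sw \<pi>\<^sub>r"
  using par(6) by (auto simp: L_fin_def irreducible_rep_def)

lemma K_action: "\<pi>\<^sub>r (K Q i) \<rho> = sw (s i) \<rho>"
proof -
  interpret W: vector_space sw using repD(1)[OF rep_r] .
  show ?thesis
    by (simp add: K_def repD[OF rep_r] one_dim_action(2)[OF par(6,7) cartan_diag] pm_def par(3)
        power2_eq_square)
qed

text \<open>Existence comes from moving the twisted module to the tensor product along v -> v tensor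
  \<rho>. Any other solution of the coproduct formulas is intertwined by the same map, so
  irreducibility, weight and inner product are transported to it as well.\<close>

lemma tensor_with_one_dim:
  fixes sv :: "complex \<Rightarrow> 'v \<Rightarrow> 'v::ab_group_add" and st :: "complex \<Rightarrow> 't \<Rightarrow> 't::ab_group_add"
  assumes lam: "lam \<in> weight_space sg h" and L: "L_fin Q (coroot_pairing B \<alpha> lam) sv \<pi>"
    and u: "unitary_rep Q (\<lambda>_. 1) sv \<pi> ip" and t: "tensor_product sv sw st t"
  shows "\<exists>\<pi>\<^sub>t. tensor_rep Q st t \<pi> \<pi>\<^sub>r \<pi>\<^sub>t"
    and "tensor_rep Q st t \<pi> \<pi>\<^sub>r \<pi>\<^sub>t \<Longrightarrow>
      L_fin Q (coroot_pairing B \<alpha> (add_weight lam lam\<^sub>r)) st \<pi>\<^sub>t \<and>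
      (\<exists>ip\<^sub>t. (\<forall>v w. ip\<^sub>t (t v \<rho>) (t w \<rho>) = ip v w) \<and> unitary_rep Q s st \<pi>\<^sub>t ip\<^sub>t)"
proof -
  have rep: "rep Q sv \<pi>" using u by (simp add: unitary_rep_def)
  note J = tensor_product_iso[OF repD(1)[OF rep] repD(1)[OF rep_r] par(7) t]
  let ?J = "\<lambda>v. t v \<rho>"
  have inv_J: "inv_into UNIV ?J (t v \<rho>) = v" for v
    using inv_f_f[of ?J v] J(2) by (simp add: bij_def)
  note iff = T.tensor_rep_iff[OF refl cartan_diag par(6,7) rep _ t]
  let ?\<pi> = "\<lambda>x. \<pi> (T.tw x)"
  have "rep Q st (\<lambda>x u. ?J (?\<pi> x (inv_into UNIV ?J u)))"
    using rep_transport[OF T.rep_twist[OF rep] J] .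
  from iff[OF this] show "\<exists>\<pi>\<^sub>t. tensor_rep Q st t \<pi> \<pi>\<^sub>r \<pi>\<^sub>t" by (auto simp: inv_J)
  assume tr: "tensor_rep Q st t \<pi> \<pi>\<^sub>r \<pi>\<^sub>t"
  then have rep_t: "rep Q st \<pi>\<^sub>t" by (simp add: tensor_rep_def)
  have int: "\<pi>\<^sub>t x (?J v) = ?J (?\<pi> x v)" if "x \<in> carrier (U_fin Q)" for x v
    using iff[OF rep_t] tr that by simp
  have L': "L_fin Q (coroot_pairing B \<alpha> (add_weight lam lam\<^sub>r)) sv ?\<pi>"
    using T.L_fin_twist[OF refl L] by (simp add: coroot_pairing_add lam par(1))
  have "L_fin Q (coroot_pairing B \<alpha> (add_weight lam lam\<^sub>r)) st \<pi>\<^sub>t"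
    by (rule L_fin_equivalent[where J = ?J, OF L' rep_t J]) (rule int)
  moreover have "s = (\<lambda>i. 1 * ar i ^ 2)" using par(3) by auto
  then have u': "unitary_rep Q s sv ?\<pi> ip"
    using T.unitary_rep_twist[OF par(2) u] by simp
  have "unitary_rep Q s st \<pi>\<^sub>t (\<lambda>u w. ip (inv_into UNIV ?J u) (inv_into UNIV ?J w))"
    by (rule unitary_rep_equivalent[where J = ?J, OF u' rep_t J]) (rule int)
  ultimately show "L_fin Q (coroot_pairing B \<alpha> (add_weight lam lam\<^sub>r)) st \<pi>\<^sub>t \<and>
      (\<exists>ip\<^sub>t. (\<forall>v w. ip\<^sub>t (t v \<rho>) (t w \<rho>) = ip v w) \<and> unitary_rep Q s st \<pi>\<^sub>t ip\<^sub>t)"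
    by (intro conjI exI[of _ "\<lambda>u w. ip (inv_into UNIV ?J u) (inv_into UNIV ?J w)"]) (simp_all add: inv_J)
qed

text \<open>Untwisting \<tau> keeps the space and the inner product, lowers the weight by that of
  the line, and changes the signs to s_i a_i^(-2) = 1. With the scalar multiplication model of the
  tensor product, v tensor \<rho> is v itself.\<close>

lemma unitary_rep_is_tensor_product:
  fixes su :: "complex \<Rightarrow> 'u \<Rightarrow> 'u::ab_group_add"
  assumes \<mu>: "\<mu> \<in> weight_space sg h" and L: "L_fin Q (coroot_pairing B \<alpha> \<mu>) su \<tau>"
    and u: "unitary_rep Q s su \<tau> ip\<^sub>u"
  shows "\<exists>lam \<pi> ip (t :: 'u \<Rightarrow> 'w \<Rightarrow> 'u).
    lam \<in> weight_space sg h \<and> \<mu> = add_weight lam lam\<^sub>r \<and>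
    L_fin Q (coroot_pairing B \<alpha> lam) su \<pi> \<and> unitary_rep Q (\<lambda>_. 1) su \<pi> ip \<and>
    tensor_product su sw su t \<and> tensor_rep Q su t \<pi> \<pi>\<^sub>r \<tau> \<and>
    (\<forall>v w. ip\<^sub>u (t v \<rho>) (t w \<rho>) = ip v w)"
proof -
  interpret I: twist_parameters Q "\<lambda>i. inverse (ar i)" ar "\<lambda>i. - lr i" lr
    by (rule T.twist_parameters_inverse)
  have rep: "rep Q su \<tau>" using u by (simp add: unitary_rep_def)
  interpret U: vector_space su using repD(1)[OF rep] .
  interpret W: vector_space sw using repD(1)[OF rep_r] .
  define lam where "lam = add_weight \<mu> (\<lambda>x. (- 1) * lam\<^sub>r x)"
  let ?\<pi> = "\<lambda>x. \<tau> (T.tw_inv x)"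
  let ?t = "\<lambda>v w. su (THE c. w = sw c \<rho>) v"
  have neg: "(\<lambda>x. (- 1) * lam\<^sub>r x) \<in> weight_space sg h"
    by (rule weight_space_scale[OF par(1)])
  have lam: "lam \<in> weight_space sg h"
    unfolding lam_def by (rule weight_space_add[OF \<mu> neg])
  have "coroot_pairing B \<alpha> lam = (\<lambda>i. coroot_pairing B \<alpha> \<mu> i + - lr i)"
    unfolding lam_def coroot_pairing_add[OF \<mu> neg] coroot_pairing_scale[OF par(1)] by simp
  moreover have "inverse (ar i) = qpow Q (of_nat (symm Q i) * (- lr i) / 2)" for i
    by (simp add: qpow_minus)
  ultimately have L': "L_fin Q (coroot_pairing B \<alpha> lam) su ?\<pi>"
    using I.L_fin_twist[OF _ L] by simp
  have "s i * inverse (ar i) ^ 2 = 1" for i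
    using T.a_nonzero[of i] by (simp add: par(3) power_inverse)
  then have u': "unitary_rep Q (\<lambda>_. 1) su ?\<pi> ip\<^sub>u"
    using I.unitary_rep_twist[OF _ u] par(2) by simp
  note t = tensor_product_one_dim[OF U.vector_space_axioms W.vector_space_axioms par(7)]
  have t\<rho>: "?t v \<rho> = v" for v using t(2)[where v = v and c = 1] by simp
  \<comment> \<open>By the criterion it suffices that twisting the untwisted action returns \<tau>,
    i.e. that \<open>tw_inv\<close> after \<open>tw\<close> is the identity on
    \<open>U_fin\<close>.\<close>
  have "tensor_rep Q su ?t ?\<pi> \<pi>\<^sub>r \<tau>"
    using T.tensor_rep_iff[OF refl cartan_diag par(6,7) I.rep_twist[OF rep] rep t(1)]
    by (simp add: t\<rho> I.tw_tw_inv)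
  moreover have "\<mu> = add_weight lam lam\<^sub>r" by (simp add: lam_def add_weight_def)
  ultimately show ?thesis
    using lam L' u' t(1) t\<rho> by (intro exI[of _ lam] exI[of _ ?\<pi>] exI[of _ ip\<^sub>u] exI[of _ ?t]) simp
qed

end

end

theorem theorem5p1:
  fixes sg :: "complex \<Rightarrow> 'g \<Rightarrow> 'g::ab_group_add"
    and br :: "'g \<Rightarrow> 'g \<Rightarrow> 'g"
    and h :: "'g set"
    and \<alpha> \<Lambda> :: "'i::finite \<Rightarrow> 'g \<Rightarrow> complex"
    and B :: "('g \<Rightarrow> complex) \<Rightarrow> ('g \<Rightarrow> complex) \<Rightarrow> complex"
    and Q :: "'i quantum_data"
  assumes g: "simple_lie_weight_data sg br h \<alpha> \<Lambda> B Q"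
    and q: "0 < qnum Q" "0 < qden Q" "coprime (qnum Q) (qden Q)"
      "\<And>i. qpow Q (of_nat (symm Q i)) \<noteq> qpow Q (- of_nat (symm Q i))"
  shows
    "(\<forall>p r lam\<^sub>r s (sw :: complex \<Rightarrow> 'w \<Rightarrow> 'w::ab_group_add) \<pi>\<^sub>r \<rho>.
        one_dim_rep Q B \<alpha> \<Lambda> p r lam\<^sub>r s sw \<pi>\<^sub>r \<rho> \<longrightarrow>
        (\<forall>i. (s i = 1 \<or> s i = - 1) \<and> \<pi>\<^sub>r (K Q i) \<rho> = sw (s i) \<rho>) \<and>
        (\<forall>lam (sv :: complex \<Rightarrow> 'v \<Rightarrow> 'v::ab_group_add) \<pi> ip
           (st :: complex \<Rightarrow> 't \<Rightarrow> 't::ab_group_add) t.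
           lam \<in> weight_space sg h \<and> L_fin Q (coroot_pairing B \<alpha> lam) sv \<pi> \<and>
           unitary_rep Q (\<lambda>_. 1) sv \<pi> ip \<and> tensor_product sv sw st t \<longrightarrow>
           (\<exists>\<pi>\<^sub>t. tensor_rep Q st t \<pi> \<pi>\<^sub>r \<pi>\<^sub>t) \<and>
           (\<forall>\<pi>\<^sub>t. tensor_rep Q st t \<pi> \<pi>\<^sub>r \<pi>\<^sub>t \<longrightarrow>
              L_fin Q (coroot_pairing B \<alpha> (add_weight lam lam\<^sub>r)) st \<pi>\<^sub>t \<and>
              (\<exists>ip\<^sub>t. (\<forall>v w. ip\<^sub>t (t v \<rho>) (t w \<rho>) = ip v w) \<and> unitary_rep Q s st \<pi>\<^sub>t ip\<^sub>t))) \<and>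
        (\<forall>\<mu> (su :: complex \<Rightarrow> 'u \<Rightarrow> 'u::ab_group_add) \<tau> ip\<^sub>u.
           \<mu> \<in> weight_space sg h \<and> L_fin Q (coroot_pairing B \<alpha> \<mu>) su \<tau> \<and>
           unitary_rep Q s su \<tau> ip\<^sub>u \<longrightarrow>
           (\<exists>lam \<pi> ip (t :: 'u \<Rightarrow> 'w \<Rightarrow> 'u).
              lam \<in> weight_space sg h \<and> \<mu> = add_weight lam lam\<^sub>r \<and>
              L_fin Q (coroot_pairing B \<alpha> lam) su \<pi> \<and> unitary_rep Q (\<lambda>_. 1) su \<pi> ip \<and>
              tensor_product su sw su t \<and> tensor_rep Q su t \<pi> \<pi>\<^sub>r \<tau> \<and>
              (\<forall>v w. ip\<^sub>u (t v \<rho>) (t w \<rho>) = ip v w)))) \<and>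
     (\<forall>s. (\<forall>i. s i = 1 \<or> s i = - 1) \<longrightarrow>
        (\<exists>p r lam\<^sub>r \<pi>\<^sub>r. one_dim_rep Q B \<alpha> \<Lambda> p r lam\<^sub>r s (*) \<pi>\<^sub>r (1::complex)))"
proof -
  interpret simple_lie_weight_data sg br h \<alpha> \<Lambda> B Q by (rule g)
  show ?thesis
  proof (intro conjI allI impI)
    fix p r lam\<^sub>r s and sw :: "complex \<Rightarrow> 'w \<Rightarrow> 'w" and \<pi>\<^sub>r \<rho> i
    assume od: "one_dim_rep Q B \<alpha> \<Lambda> p r lam\<^sub>r s sw \<pi>\<^sub>r \<rho>"
    show "s i = 1 \<or> s i = - 1" by (rule one_dim_rep_parameters(4)[OF q(1,2) od])
    show "\<pi>\<^sub>r (K Q i) \<rho> = sw (s i) \<rho>" by (rule K_action[OF q(1,2) od])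
  next
    fix p r lam\<^sub>r s and sw :: "complex \<Rightarrow> 'w \<Rightarrow> 'w" and \<pi>\<^sub>r \<rho> lam
      and sv :: "complex \<Rightarrow> 'v \<Rightarrow> 'v" and \<pi> ip
      and st :: "complex \<Rightarrow> 't \<Rightarrow> 't" and t
    assume od: "one_dim_rep Q B \<alpha> \<Lambda> p r lam\<^sub>r s sw \<pi>\<^sub>r \<rho>"
      and *: "lam \<in> weight_space sg h \<and> L_fin Q (coroot_pairing B \<alpha> lam) sv \<pi> \<and>
        unitary_rep Q (\<lambda>_. 1) sv \<pi> ip \<and> tensor_product sv sw st t"
    note tensor = tensor_with_one_dim[OF q(1,2) od, of lam sv \<pi> ip st t]
    show "\<exists>\<pi>\<^sub>t. tensor_rep Q st t \<pi> \<pi>\<^sub>r \<pi>\<^sub>t" using * by (intro tensor) simp_all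
    fix \<pi>\<^sub>t assume tr: "tensor_rep Q st t \<pi> \<pi>\<^sub>r \<pi>\<^sub>t"
    show "L_fin Q (coroot_pairing B \<alpha> (add_weight lam lam\<^sub>r)) st \<pi>\<^sub>t"
      "\<exists>ip\<^sub>t. (\<forall>v w. ip\<^sub>t (t v \<rho>) (t w \<rho>) = ip v w) \<and> unitary_rep Q s st \<pi>\<^sub>t ip\<^sub>t"
      using tensor(2)[OF _ _ _ _ tr] * by simp_all
  next
    fix p r lam\<^sub>r s and sw :: "complex \<Rightarrow> 'w \<Rightarrow> 'w" and \<pi>\<^sub>r \<rho> \<mu>
      and su :: "complex \<Rightarrow> 'u \<Rightarrow> 'u" and \<tau> ip\<^sub>u
    assume od: "one_dim_rep Q B \<alpha> \<Lambda> p r lam\<^sub>r s sw \<pi>\<^sub>r \<rho>"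
      and *: "\<mu> \<in> weight_space sg h \<and> L_fin Q (coroot_pairing B \<alpha> \<mu>) su \<tau> \<and> unitary_rep Q s su \<tau> ip\<^sub>u"
    show "\<exists>lam \<pi> ip (t :: 'u \<Rightarrow> 'w \<Rightarrow> 'u).
        lam \<in> weight_space sg h \<and> \<mu> = add_weight lam lam\<^sub>r \<and>
        L_fin Q (coroot_pairing B \<alpha> lam) su \<pi> \<and> unitary_rep Q (\<lambda>_. 1) su \<pi> ip \<and>
        tensor_product su sw su t \<and> tensor_rep Q su t \<pi> \<pi>\<^sub>r \<tau> \<and>
        (\<forall>v w. ip\<^sub>u (t v \<rho>) (t w \<rho>) = ip v w)"
      using * by (intro unitary_rep_is_tensor_product[OF q(1,2) od]) simp_all
  next
    \<comment> \<open>The converse direction starts from a line with the given signs; this clause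
      guarantees that every choice of signs has one, so that all these real forms are
      covered.\<close>
    fix s :: "'i \<Rightarrow> complex" assume "\<forall>i. s i = 1 \<or> s i = - 1"
    then show "\<exists>p r lam\<^sub>r \<pi>\<^sub>r. one_dim_rep Q B \<alpha> \<Lambda> p r lam\<^sub>r s (*) \<pi>\<^sub>r (1::complex)"
      by (intro one_dim_rep_exists[OF q(1,2)]) simp
  qed
qed

end
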